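(* Let $D\subset\mathbb C^N$ be a domain equipped with a foliation $\mathcal F$ of class $C^2$ whose leaves are holomorphic curves. Let $E\subset D$ be a closed set which is a union of leaves of $\mathcal F$, with $H_{2N}(E)=0$. Let $F\in L^1(D)$ be holomorphic on $D\setminus E$. If $F$ extends holomorphically to an open set $D'\subset D$ which intersects every leaf of $\mathcal F$ contained in $E$, then $F$ extends holomorphically to all of $D$. *)

theory Defs
  imports "HOL-Analysis.Analysis" "HOL-Complex_Analysis.Complex_Analysis"
begin

section \<open>Hausdorff measure (unnormalised; the normalising constant is irrelevant for null sets)\<close>

definition hausdorff_measure :: "real \<Rightarrow> 'a::metric_space set \<Rightarrow> ennreal" where
  "hausdorff_measure s E =
     (SUP \<delta>\<in>{0<..}. INF C\<in>{C :: nat \<Rightarrow> 'a set.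
          (\<forall>i. bounded (C i) \<and> diameter (C i) \<le> \<delta>) \<and> E \<subseteq> (\<Union>i. C i)}.
        (\<Sum>i. ennreal (diameter (C i) powr s)))"

definition holo_on :: "(complex ^ 'n::finite) set \<Rightarrow> (complex ^ 'n \<Rightarrow> complex) \<Rightarrow> bool" where
  "holo_on S f \<longleftrightarrow>
     (\<forall>x\<in>S. \<exists>f'. (f has_derivative f') (at x) \<and> (\<forall>c v. f' (c *s v) = c * f' v))"

definition C2_on :: "'a::euclidean_space set \<Rightarrow> ('a \<Rightarrow> 'b::euclidean_space) \<Rightarrow> bool" where
  "C2_on S f \<longleftrightarrow>
     (\<exists>(Df :: 'a \<Rightarrow> 'a \<Rightarrow>\<^sub>L 'b) (D2f :: 'a \<Rightarrow> 'a \<Rightarrow>\<^sub>L ('a \<Rightarrow>\<^sub>L 'b)).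
        (\<forall>x\<in>S. (f has_derivative blinfun_apply (Df x)) (at x)) \<and>
        (\<forall>x\<in>S. (Df has_derivative blinfun_apply (D2f x)) (at x)) \<and>
        continuous_on S D2f)"

definition slice :: "'n::finite \<Rightarrow> complex ^ 'n \<Rightarrow> (complex ^ 'n) set" where
  "slice j c = {z. \<forall>k. k \<noteq> j \<longrightarrow> z $ k = c $ k}"

definition line_param :: "'n::finite \<Rightarrow> complex ^ 'n \<Rightarrow> complex \<Rightarrow> complex ^ 'n" where
  "line_param j c \<zeta> = (\<chi> i. if i = j then \<zeta> else c $ i)"

definition fol_chart ::
  "'n::finite \<Rightarrow> (complex ^ 'n) set \<Rightarrow> (complex ^ 'n) set \<Rightarrow> (complex ^ 'n \<Rightarrow> complex ^ 'n)
     \<Rightarrow> (complex ^ 'n \<Rightarrow> complex ^ 'n) \<Rightarrow> bool" where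
  "fol_chart j D U \<psi> \<phi> \<longleftrightarrow>
     open U \<and> U \<subseteq> D \<and> open (\<psi> ` U) \<and>
     (\<forall>x\<in>U. \<phi> (\<psi> x) = x) \<and>
     C2_on U \<psi> \<and> C2_on (\<psi> ` U) \<phi> \<and>
     (\<forall>c k. (\<lambda>\<zeta>. \<phi> (line_param j c \<zeta>) $ k) holomorphic_on {\<zeta>. line_param j c \<zeta> \<in> \<psi> ` U})"

definition holo_foliation ::
  "'n::finite \<Rightarrow> (complex ^ 'n) set
     \<Rightarrow> ((complex ^ 'n) set \<times> (complex ^ 'n \<Rightarrow> complex ^ 'n) \<times> (complex ^ 'n \<Rightarrow> complex ^ 'n)) set
     \<Rightarrow> bool" where
  "holo_foliation j D A \<longleftrightarrow>
     (\<forall>(U, \<psi>, \<phi>)\<in>A. fol_chart j D U \<psi> \<phi>) \<and>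
     (\<Union>(U, \<psi>, \<phi>)\<in>A. U) = D \<and>
     (\<forall>(U1, \<psi>1, \<phi>1)\<in>A. \<forall>(U2, \<psi>2, \<phi>2)\<in>A. \<forall>x\<in>U1 \<inter> U2. \<exists>e>0.
        \<forall>y\<in>U1 \<inter> U2 \<inter> ball x e. \<psi>1 y \<in> slice j (\<psi>1 x) \<longrightarrow> \<psi>2 y \<in> slice j (\<psi>2 x))"

definition same_plaque where
  "same_plaque j A x y \<longleftrightarrow>
     (\<exists>(U, \<psi>, \<phi>)\<in>A. x \<in> U \<and> y \<in> connected_component_set (U \<inter> \<psi> -` slice j (\<psi> x)) x)"

definition leaf where
  "leaf j A x = {y. (same_plaque j A)\<^sup>*\<^sup>* x y}"

definition leaves where
  "leaves j D A = leaf j A ` D"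

end

theory Submission
  imports Defs
begin

text \<open>
  In a foliation chart let g be the pulled-back function. It is holomorphic along every leaf off the
  null set K of exceptional leaves, and extends across a small disc in some exceptional leaf. Its
  Taylor coefficients a_n(h) along the leaf through h are then C^1 in h, with a_n and its (Lipschitz)
  transversal gradient of size O(r^-n), where r is the radius of the small disc. Since g is
  integrable, the average of |a_n| is O(R^-n), where R > r is the radius of the full disc.
  Interpolating between the two, a_n and its gradient are O(s^-n) near h = 0 for some s > r, so
  the Taylor series extends g as a C^1 function past the radius r. This extension agrees with F
  off a null set, hence its differential is complex linear everywhere, and it is holomorphic.
  Iterating, the extension reaches the whole disc of radius R, and then runs along the entire leaf.
\<close>

subsection \<open>Null sets and Lipschitz images\<close>

text \<open>The obstacle is that the charts are only C^2 across the leaves. The coefficients a_n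
  need not be holomorphic in h, nor |a_n| subharmonic, so no mean value inequality turns the bound
  on averages into a uniform one. The substitute is metric: a Lipschitz function that is small at
  one point of a tiny ball is small on the whole ball. The tiny ball costs a factor exponential in
  n, which is affordable only if r \<le> R p^(2m+2), with m the real dimension and 0 < p < 1; the
  gain is then a factor 1/p in the radius. The gain degenerates as r approaches R, so the iteration
  takes the form of a supremum argument. Two circles are needed because they carry different
  information: on the small one g is C^1 in h for every h, on the large one it is known only for h
  off K, and only in L^1. The second derivatives of the charts serve to make the differential of g
  locally Lipschitz. Since E is null, a continuous extension is determined by F; there is no
  monodromy, and everything can be phrased with one largest domain of extension.\<close>

lemma hausdorff_measure_zero_imp_negligible:
  fixes E :: "'a::euclidean_space set"
  assumes "hausdorff_measure (real DIM('a)) E = 0"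
  shows "negligible E"
  unfolding negligible_outer_le
proof (intro allI impI)
  fix e :: real assume e: "e > 0"
  let ?m = "DIM('a)"
  let ?v = "unit_ball_vol (real ?m)"
  have v: "?v > 0" "?v \<noteq> 0" by (simp, metis less_irrefl of_nat_0_le_iff unit_ball_vol_pos)
  let ?\<C> = "{C :: nat \<Rightarrow> 'a set. (\<forall>i. bounded (C i) \<and> diameter (C i) \<le> 1) \<and> E \<subseteq> (\<Union>i. C i)}"
  \<comment> \<open>The supremum over \<delta> is 0, so the single scale \<delta> = 1 already
    provides coverings of arbitrarily small total weight.\<close>
  have "(INF C\<in>?\<C>. (\<Sum>i. ennreal (diameter (C i) powr ?m))) \<le> hausdorff_measure (real ?m) E"
    unfolding hausdorff_measure_def by (rule SUP_upper2[of 1]) auto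
  also have "\<dots> < ennreal (e / ?v)" using assms e v by simp
  finally obtain C where C: "C \<in> ?\<C>"
    and sum: "(\<Sum>i. ennreal (diameter (C i) powr ?m)) < ennreal (e / ?v)"
    unfolding INF_less_iff by blast
  \<comment> \<open>A set lies in the closed ball about any of its points with its diameter as
    radius, so balls of computable volume replace the \<open>C i\<close>. For empty
    \<open>C i\<close> the point is arbitrary and the ball has radius 0.\<close>
  define a where "a i = (SOME x. x \<in> C i)" for i
  define T where "T = (\<Union>i. cball (a i) (diameter (C i)))"
  have "E \<subseteq> T"
  proof
    fix x assume "x \<in> E"
    then obtain i where i: "x \<in> C i" using C by auto
    then have "a i \<in> C i" unfolding a_def by (rule someI)
    then have "dist (a i) x \<le> diameter (C i)" using diameter_bounded_bound[of "C i" "a i" x] C i by auto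
    then show "x \<in> T" unfolding T_def by auto
  qed
  have T: "T \<in> sets lborel" unfolding T_def by auto
  have "emeasure lborel T \<le> (\<Sum>i. emeasure lborel (cball (a i) (diameter (C i))))"
    unfolding T_def by (rule emeasure_subadditive_countably) auto
  also have "\<dots> = (\<Sum>i. ennreal ?v * ennreal (diameter (C i) powr ?m))"
  proof (intro arg_cong[where f=suminf] ext)
    fix i
    have d: "diameter (C i) \<ge> 0" using C diameter_ge_0 by auto
    have "diameter (C i) ^ ?m = diameter (C i) powr ?m"
      using d by (cases "diameter (C i) = 0") (auto simp: powr_realpow)
    then show "emeasure lborel (cball (a i) (diameter (C i))) = ennreal ?v * ennreal (diameter (C i) powr ?m)"
      using d by (simp add: emeasure_cball ennreal_mult')
  qed
  also have "\<dots> = ennreal ?v * (\<Sum>i. ennreal (diameter (C i) powr ?m))" by simp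
  also have "\<dots> \<le> ennreal ?v * ennreal (e / ?v)" using sum by (intro mult_left_mono) auto
  also have "\<dots> = ennreal e" using v e by (simp flip: ennreal_mult')
  finally have em: "emeasure lborel T \<le> ennreal e" .
  have "T \<in> lmeasurable" using T em by (auto simp: fmeasurable_def intro: le_less_trans)
  moreover have "measure lebesgue T \<le> e"
    using em e T by (simp add: measure_def enn2real_leI)
  ultimately show "\<exists>T. E \<subseteq> T \<and> T \<in> lmeasurable \<and> measure lebesgue T \<le> e"
    using \<open>E \<subseteq> T\<close> by blast
qed

text \<open>The families produced by Vitali's lemma are indexed by their centres. Integrating over
  \<open>count_space\<close> gives subadditivity for such an index set without enumerating
  it.\<close>

lemma emeasure_UN_le_nn_integral_count_space:
  assumes "countable I" and A: "\<And>i. i \<in> I \<Longrightarrow> A i \<in> sets M"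
  shows "emeasure M (\<Union>i\<in>I. A i) \<le> (\<integral>\<^sup>+i. emeasure M (A i) \<partial>count_space I)"
proof -
  have "emeasure M (\<Union>i\<in>I. A i) = (\<integral>\<^sup>+x. indicator (\<Union>i\<in>I. A i) x \<partial>M)"
    using assms by (intro nn_integral_indicator[symmetric] sets.countable_UN') auto
  also have "\<dots> \<le> (\<integral>\<^sup>+x. \<integral>\<^sup>+i. indicator (A i) x \<partial>count_space I \<partial>M)"
  proof (intro nn_integral_mono)
    fix x
    show "indicator (\<Union>i\<in>I. A i) x \<le> (\<integral>\<^sup>+i. indicator (A i) x \<partial>count_space I :: ennreal)"
    proof (cases "x \<in> (\<Union>i\<in>I. A i)")
      case True
      then obtain i where "i \<in> I" "x \<in> A i" by blast
      then show ?thesis using nn_integral_ge_point[of i I "\<lambda>i. indicator (A i) x"] True by simp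
    qed simp
  qed
  also have "\<dots> = (\<integral>\<^sup>+i. \<integral>\<^sup>+x. indicator (A i) x \<partial>M \<partial>count_space I)"
    using A by (intro nn_integral_count_space_nn_integral \<open>countable I\<close>) auto
  also have "\<dots> = (\<integral>\<^sup>+i. emeasure M (A i) \<partial>count_space I)"
    using A by (intro nn_integral_cong) auto
  finally show ?thesis .
qed

text \<open>Vitali's covering lemma replaces the exact change of variables: a crude constant suffices.\<close>

lemma emeasure_lipschitz_image_le:
  fixes f :: "'a::euclidean_space \<Rightarrow> 'a"
  assumes "open V" "L \<ge> 0" and lip: "\<And>x y. x \<in> V \<Longrightarrow> y \<in> V \<Longrightarrow> dist (f x) (f y) \<le> L * dist x y"
  shows "emeasure lborel (f ` V) \<le> ennreal ((5 * L) ^ DIM('a)) * emeasure lborel V"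
\<comment> \<open>Outside the Borel sets \<open>emeasure\<close> is 0 by convention, which settles
  the other case.\<close>
proof (cases "f ` V \<in> sets lborel")
  case True
  let ?m = "DIM('a)"
  let ?v = "unit_ball_vol (real ?m)"
  \<comment> \<open>Vitali's lemma asks for bounded radii, hence the cut at 1.\<close>
  have "\<exists>r. 0 < r \<and> r \<le> 1 \<and> cball x r \<subseteq> V" if "x \<in> V" for x
  proof -
    obtain e where "e > 0" "cball x e \<subseteq> V" using \<open>open V\<close> \<open>x \<in> V\<close> open_contains_cball by blast
    then show ?thesis by (intro exI[of _ "min e 1"]) (auto)
  qed
  then obtain r where r: "\<And>x. x \<in> V \<Longrightarrow> 0 < r x \<and> r x \<le> 1 \<and> cball x (r x) \<subseteq> V" by metis
  have "x \<in> cball x (r x)" if "x \<in> V" for x using r[OF that] by simp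
  then have "V \<subseteq> (\<Union>i\<in>V. cball i (r i))" by blast
  then obtain C where C: "countable C" "C \<subseteq> V"
     "pairwise (\<lambda>i j. disjnt (cball i (r i)) (cball j (r j))) C"
     "V \<subseteq> (\<Union>i\<in>C. cball i (5 * r i))"
    by (rule Vitali_covering_lemma_cballs[of V "\<lambda>x. x" r V 1]) (use r in auto)
  have "f ` V \<subseteq> (\<Union>i\<in>C. cball (f i) (5 * L * r i))"
  proof
    fix y assume "y \<in> f ` V"
    then obtain x where x: "x \<in> V" "y = f x" by blast
    then obtain i where i: "i \<in> C" "dist i x \<le> 5 * r i" using C(4) by auto
    then have "dist (f i) (f x) \<le> L * (5 * r i)" 
      using lip[of i x] C(2) x mult_left_mono[OF i(2) \<open>L \<ge> 0\<close>] by (meson order_trans subsetD)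
    then show "y \<in> (\<Union>i\<in>C. cball (f i) (5 * L * r i))" using i x by (auto simp: algebra_simps)
  qed
  then have "emeasure lborel (f ` V) \<le> emeasure lborel (\<Union>i\<in>C. cball (f i) (5 * L * r i))"
    by (intro emeasure_mono sets.countable_UN' C(1)) auto
  also have "\<dots> \<le> (\<integral>\<^sup>+i. emeasure lborel (cball (f i) (5 * L * r i)) \<partial>count_space C)"
    by (rule emeasure_UN_le_nn_integral_count_space) (use C in auto)
  also have "\<dots> = (\<integral>\<^sup>+i. ennreal ((5 * L) ^ ?m) * emeasure lborel (cball i (r i)) \<partial>count_space C)"
  proof (intro nn_integral_cong)
    fix i assume "i \<in> space (count_space C)"
    then have "r i > 0" using C r by auto
    then show "emeasure lborel (cball (f i) (5 * L * r i)) = ennreal ((5 * L) ^ ?m) * emeasure lborel (cball i (r i))"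
      using \<open>L \<ge> 0\<close> by (subst (1 2) emeasure_cball, simp_all)
        (subst ennreal_mult'[symmetric], simp, simp add: power_mult_distrib mult_ac)
  qed
  also have "\<dots> = ennreal ((5 * L) ^ ?m) * (\<integral>\<^sup>+i. emeasure lborel (cball i (r i)) \<partial>count_space C)"
    by (rule nn_integral_cmult) auto
  also have "(\<integral>\<^sup>+i. emeasure lborel (cball i (r i)) \<partial>count_space C) = emeasure lborel (\<Union>i\<in>C. cball i (r i))"
    by (rule emeasure_UN_countable[symmetric]) 
      (use C in \<open>auto simp: disjoint_family_on_def pairwise_def disjnt_def\<close>)
  also have "\<dots> \<le> emeasure lborel V"
    by (intro emeasure_mono) (use C r \<open>open V\<close> in auto)
  finally show ?thesis by (simp add: mult_left_mono)
qed (simp add: emeasure_notin_sets)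

text \<open>The preimage of a set under \<phi> is the image of part of that set under the Lipschitz
  map \<psi>, so the push-forward of Lebesgue measure by \<phi> is dominated by a multiple of
  Lebesgue measure. This is how integrability of F passes to chart coordinates.\<close>

lemma nn_integral_lipschitz_inverse_le:
  fixes \<phi> \<psi> :: "'a::euclidean_space \<Rightarrow> 'a" and g :: "'a \<Rightarrow> ennreal"
  assumes "open P" "open Q" "L \<ge> 0" "continuous_on P \<phi>" "\<phi> ` P \<subseteq> Q"
    and inv: "\<And>x. x \<in> P \<Longrightarrow> \<psi> (\<phi> x) = x"
    and cont: "continuous_on Q \<psi>" and inv2: "\<And>x. x \<in> Q \<Longrightarrow> \<phi> (\<psi> x) = x"
    and lip: "\<And>x y. x \<in> Q \<Longrightarrow> y \<in> Q \<Longrightarrow> dist (\<psi> x) (\<psi> y) \<le> L * dist x y"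
    and g: "g \<in> borel_measurable borel"
  shows "(\<integral>\<^sup>+x\<in>P. g (\<phi> x) \<partial>lborel) \<le> ennreal ((5 * L) ^ DIM('a)) * (\<integral>\<^sup>+x. g x \<partial>lborel)"
proof -
  let ?c = "ennreal ((5 * L) ^ DIM('a))"
  have P: "P \<in> sets lborel" using \<open>open P\<close> by auto
  have \<phi>m: "\<phi> \<in> measurable (restrict_space lborel P) borel"
    using borel_measurable_continuous_on_restrict[OF \<open>continuous_on P \<phi>\<close>]
    by (simp add: measurable_def sets_restrict_space space_restrict_space)
  let ?M = "distr (restrict_space lborel P) borel \<phi>"
  let ?N = "scale_measure ?c lborel"
  have le: "emeasure ?M A \<le> ?c * emeasure lborel A" if A: "A \<in> sets borel" for A
  proof -
    have "emeasure ?M A \<le> ?c * emeasure lborel A + ennreal e" if e: "e > 0" for e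
    proof -
      \<comment> \<open>The image estimate holds for open sets, so A is enlarged to an open U with
        error e', small enough to survive the factor (5 L)^m. The summand 1 covers L = 0.\<close>
      define e' where "e' = e / ((5 * L) ^ DIM('a) + 1)"
      have "(5 * L) ^ DIM('a) + 1 > 0" using \<open>L \<ge> 0\<close> by (intro add_nonneg_pos) auto
      then have "e' > 0" unfolding e'_def using e by simp
      obtain U where U: "open U" "A \<subseteq> U" "emeasure lborel (U - A) < ennreal e'"
        using outer_regular_lborel[OF A \<open>e' > 0\<close>] by blast
      define V where "V = {z \<in> Q. \<psi> z \<in> P} \<inter> U"
      have "open {z \<in> Q. \<psi> z \<in> P}"
        using continuous_open_preimage[OF cont \<open>open Q\<close> \<open>open P\<close>] by (simp add: vimage_def Int_def)
      then have V: "open V" using U unfolding V_def by auto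
      have VQ: "V \<subseteq> Q" unfolding V_def by auto
      have eq: "\<psi> ` V = {x\<in>P. \<phi> x \<in> U}"
        using assms(5) inv inv2 unfolding V_def by force
      have "open {x\<in>P. \<phi> x \<in> U}"
        using continuous_open_preimage[OF assms(4,1) U(1)] by (simp add: vimage_def Int_def)
      have "emeasure ?M A = emeasure lborel (\<phi> -` A \<inter> P)"
        using A \<phi>m P by (simp add: emeasure_distr emeasure_restrict_space space_restrict_space)
      also have "\<dots> \<le> emeasure lborel {x\<in>P. \<phi> x \<in> U}"
        using U \<open>open {x\<in>P. \<phi> x \<in> U}\<close> by (intro emeasure_mono) auto
      also have "\<dots> \<le> ?c * emeasure lborel V"
        unfolding eq[symmetric] using emeasure_lipschitz_image_le[OF V \<open>L \<ge> 0\<close>, of \<psi>] lip VQ by blast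
      also have "\<dots> \<le> ?c * (emeasure lborel A + ennreal e')"
      proof (intro mult_left_mono)
        have "emeasure lborel V \<le> emeasure lborel (A \<union> (U - A))"
          by (intro emeasure_mono) (use A U in \<open>auto simp: V_def\<close>)
        also have "\<dots> \<le> emeasure lborel A + emeasure lborel (U - A)"
          by (intro emeasure_subadditive) (use A U in auto)
        finally show "emeasure lborel V \<le> emeasure lborel A + ennreal e'"
          using U(3) by (meson add_left_mono order.strict_implies_order order_trans)
      qed auto
      also have "\<dots> = ?c * emeasure lborel A + ?c * ennreal e'" by (simp add: distrib_left)
      also have "?c * ennreal e' \<le> ennreal e"
      proof -
        have "(5 * L) ^ DIM('a) * e' \<le> e"
        proof -
          have "(5 * L) ^ DIM('a) * e \<le> e * ((5 * L) ^ DIM('a) + 1)" using e by (simp add: algebra_simps)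
          then show ?thesis unfolding e'_def using \<open>(5 * L) ^ DIM('a) + 1 > 0\<close> by (simp only: times_divide_eq_right pos_divide_le_eq)
        qed
        moreover have "?c * ennreal e' = ennreal ((5 * L) ^ DIM('a) * e')"
          by (rule ennreal_mult'[symmetric]) (use \<open>L \<ge> 0\<close> in simp)
        ultimately show ?thesis by (metis ennreal_leI)
      qed
      finally show ?thesis by (simp add: add_left_mono)
    qed
    then show ?thesis by (metis ennreal_le_epsilon)
  qed
  have "?M \<le> ?N"
    by (subst le_measure) (use le in simp_all)
  have "(\<integral>\<^sup>+x\<in>P. g (\<phi> x) \<partial>lborel) = (\<integral>\<^sup>+x. g (\<phi> x) \<partial>restrict_space lborel P)"
    by (subst nn_integral_restrict_space) (use P in auto)
  also have "\<dots> = (\<integral>\<^sup>+x. g x \<partial>?M)" using \<phi>m g by (simp add: nn_integral_distr)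
  also have "\<dots> \<le> (\<integral>\<^sup>+x. g x \<partial>?N)"
    by (intro nn_integral_mono_measure \<open>?M \<le> ?N\<close>) simp
  also have "\<dots> = ?c * (\<integral>\<^sup>+x. g x \<partial>lborel)"
    using g by (intro nn_integral_scale_measure) auto
  finally show ?thesis .
qed

subsection \<open>Taylor coefficients as circle averages\<close>

text \<open>Cauchy's integral for the n-th Taylor coefficient at 0, with dz/(2 pi i z) written as
  dt. In this form it makes sense for every continuous function on the circle and is linear in it,
  so it can be estimated and differentiated in a parameter without holomorphy.\<close>

definition circle_coeff :: "real \<Rightarrow> nat \<Rightarrow> (complex \<Rightarrow> complex) \<Rightarrow> complex" where
  "circle_coeff r n u = integral {0..1} (\<lambda>t. u (circlepath 0 r t) / circlepath 0 r t ^ n)"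

lemma norm_circlepath_0: "norm (circlepath 0 r t) = \<bar>r\<bar>"
  by (simp add: circlepath norm_mult)

lemma continuous_on_circlepath_0: "continuous_on A (circlepath 0 r)"
  unfolding circlepath by (intro continuous_intros)

lemma continuous_on_circle_integrand:
  assumes "0 < r" "continuous_on (sphere 0 r) u"
  shows "continuous_on {0..1} (\<lambda>t. u (circlepath 0 r t) / circlepath 0 r t ^ n)"
proof -
  have "circlepath 0 r t \<noteq> 0" for t
    using norm_circlepath_0[of r t] assms by (metis abs_of_pos norm_zero less_irrefl)
  moreover have "continuous_on {0..1} (\<lambda>t. u (circlepath 0 r t))"
    by (rule continuous_on_compose2[OF assms(2) continuous_on_circlepath_0])
      (use assms norm_circlepath_0 in auto)
  ultimately show ?thesis by (intro continuous_intros continuous_on_circlepath_0) auto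
qed

lemma circle_coeff_has_integral:
  assumes "0 < r" "continuous_on (sphere 0 r) u"
  shows "((\<lambda>t. u (circlepath 0 r t) / circlepath 0 r t ^ n) has_integral circle_coeff r n u) {0..1}"
  unfolding circle_coeff_def
  by (intro integrable_integral integrable_continuous_real continuous_on_circle_integrand assms)

lemma circle_coeff_add:
  assumes "0 < r" "continuous_on (sphere 0 r) u" "continuous_on (sphere 0 r) v"
  shows "circle_coeff r n (\<lambda>w. u w + v w) = circle_coeff r n u + circle_coeff r n v"
proof -
  have "((\<lambda>t. (u (circlepath 0 r t) + v (circlepath 0 r t)) / circlepath 0 r t ^ n) 
      has_integral circle_coeff r n u + circle_coeff r n v) {0..1}"
    unfolding add_divide_distrib by (intro has_integral_add circle_coeff_has_integral assms)
  then show ?thesis unfolding circle_coeff_def[of r n "\<lambda>w. u w + v w"] by (rule integral_unique)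
qed

lemma circle_coeff_diff:
  assumes "0 < r" "continuous_on (sphere 0 r) u" "continuous_on (sphere 0 r) v"
  shows "circle_coeff r n (\<lambda>w. u w - v w) = circle_coeff r n u - circle_coeff r n v"
proof -
  have "((\<lambda>t. (u (circlepath 0 r t) - v (circlepath 0 r t)) / circlepath 0 r t ^ n) 
      has_integral circle_coeff r n u - circle_coeff r n v) {0..1}"
    unfolding diff_divide_distrib by (intro has_integral_diff circle_coeff_has_integral assms)
  then show ?thesis unfolding circle_coeff_def[of r n "\<lambda>w. u w - v w"] by (rule integral_unique)
qed

lemma circle_coeff_scaleR:
  "circle_coeff r n (\<lambda>w. c *\<^sub>R u w) = c *\<^sub>R circle_coeff r n u"
proof -
  have "(c *\<^sub>R u w) / w ^ n = c *\<^sub>R (u w / w ^ n)" for w by (simp add: scaleR_conv_of_real)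
  then show ?thesis unfolding circle_coeff_def by (simp only: integral_cmul)
qed

lemma norm_circle_coeff_le:
  assumes "0 < r" "continuous_on (sphere 0 r) u" "\<And>w. norm w = r \<Longrightarrow> norm (u w) \<le> B"
  shows "norm (circle_coeff r n u) \<le> B / r ^ n"
proof -
  have "norm (circle_coeff r n u) \<le> B / r ^ n * (1 - 0)"
    unfolding circle_coeff_def
    by (intro integral_bound continuous_on_circle_integrand assms(1,2))
      (use assms(1,3) in \<open>auto simp: norm_divide norm_power norm_circlepath_0 intro!: divide_right_mono\<close>)
  then show ?thesis by simp
qed

text \<open>Besides identifying the integral, this shows that it does not depend on r as long as the
  function is holomorphic near the closed disc; a coefficient read off a small circle can therefore
  be estimated on a large one.\<close>

lemma circle_coeff_eq_deriv:
  assumes "0 < r" "open S" "cball 0 r \<subseteq> S" "u holomorphic_on S"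
  shows "circle_coeff r n u = (deriv ^^ n) u 0 / fact n"
proof -
  have c0: "circlepath 0 r t \<noteq> 0" for t
    using norm_circlepath_0[of r t] assms by (metis abs_of_pos norm_zero less_irrefl)
  have hol: "u holomorphic_on ball 0 r" "continuous_on (cball 0 r) u"
    using assms holomorphic_on_subset holomorphic_on_imp_continuous_on ball_subset_cball by blast+
  have "((\<lambda>w. u w / (w - 0) ^ Suc n) has_contour_integral
        complex_of_real (2 * pi) * \<i> / fact n * (deriv ^^ n) u 0) (circlepath 0 r)"
    by (rule Cauchy_has_contour_integral_higher_derivative_circlepath) (use hol assms in auto)
  then have "((\<lambda>t. 2 * pi * \<i> * (u (circlepath 0 r t) / circlepath 0 r t ^ n)) has_integral
        2 * pi * \<i> * ((deriv ^^ n) u 0 / fact n)) {0..1}"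
    unfolding has_contour_integral_def
  proof (rule has_integral_eq_rhs[OF has_integral_eq, rotated])
    fix t :: real assume "t \<in> {0..1}"
    then have "vector_derivative (circlepath 0 r) (at t within {0..1}) = 2 * pi * \<i> * circlepath 0 r t"
      by (simp add: vector_derivative_circlepath01, simp add: circlepath)
    then show "u (circlepath 0 r t) / (circlepath 0 r t - 0) ^ Suc n * vector_derivative (circlepath 0 r) (at t within {0..1}) 
       = 2 * pi * \<i> * (u (circlepath 0 r t) / circlepath 0 r t ^ n)"
      using c0[of t] by (simp add: field_simps)
  qed simp
  from has_integral_mult_right[OF this, of "1 / (2 * pi * \<i>)"]
  have "((\<lambda>t. u (circlepath 0 r t) / circlepath 0 r t ^ n) has_integral (deriv ^^ n) u 0 / fact n) {0..1}"
    by simp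
  then show ?thesis unfolding circle_coeff_def by (rule integral_unique)
qed

text \<open>On the large circle only L^1 information is at hand, so the mean of |u| takes the place
  of its maximum. The nonnegative integral on the right is ready for Fubini.\<close>

lemma circle_coeff_le_nn_integral:
  assumes "0 < r" "continuous_on (sphere 0 r) u"
  shows "ennreal (norm (circle_coeff r n u) * r ^ n) \<le> (\<integral>\<^sup>+t\<in>{0..1}. ennreal (norm (u (circlepath 0 r t))) \<partial>lborel)"
proof -
  let ?f = "\<lambda>t. norm (u (circlepath 0 r t))"
  have ci: "continuous_on {0..1} (\<lambda>t. u (circlepath 0 r t))"
    using continuous_on_circle_integrand[OF assms, of 0] by simp
  have c: "continuous_on {0..1} ?f" by (intro continuous_intros ci)
  have I: "(?f has_integral integral {0..1} ?f) {0..1}"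
    by (intro integrable_integral integrable_continuous_real c)
  have I2: "((\<lambda>t. ?f t / r ^ n) has_integral (integral {0..1} ?f / r ^ n)) {0..1}"
    by (rule has_integral_divide[OF I])
  have "norm (circle_coeff r n u) \<le> integral {0..1} ?f / r ^ n"
    unfolding integral_unique[OF I2, symmetric] circle_coeff_def
    by (rule integral_norm_bound_integral)
      (use assms I2 in \<open>auto simp: norm_divide norm_power norm_circlepath_0 
         intro!: integrable_continuous_real continuous_on_circle_integrand c\<close>)
  then have "norm (circle_coeff r n u) * r ^ n \<le> integral {0..1} ?f"
    using assms(1) by (simp add: field_simps)
  moreover have "(\<integral>\<^sup>+t\<in>{0..1}. ennreal (?f t) \<partial>lborel) = ennreal (integral {0..1} ?f)"
    by (rule nn_integral_has_integral_lebesgue'[OF _ I]) auto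
  ultimately show ?thesis by (simp add: ennreal_leI)
qed

section \<open>Dependence of the coefficients on the transversal parameter\<close>

text \<open>Stands in for differentiation under the integral sign: a quadratic remainder bound that
  is uniform on the circle survives integration, and it yields the derivative of the
  coefficient.\<close>

lemma has_derivative_of_quadratic_remainder:
  fixes f :: "'a::real_normed_vector \<Rightarrow> 'b::real_normed_vector"
  assumes "bounded_linear f'" "open S" "x \<in> S"
    and rem: "\<And>y. y \<in> S \<Longrightarrow> norm (f y - f x - f' (y - x)) \<le> c * (norm (y - x))\<^sup>2"
  shows "(f has_derivative f') (at x)"
  unfolding has_derivative_at_alt
proof (intro conjI allI impI assms(1))
  fix e :: real assume "e > 0"
  obtain d where d: "d > 0" "ball x d \<subseteq> S" using assms by (meson open_contains_ball)
  define d' where "d' = min d (e / (\<bar>c\<bar> + 1))"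
  have "d' > 0" using d \<open>e > 0\<close> by (simp add: d'_def)
  moreover have "norm (f y - f x - f' (y - x)) \<le> e * norm (y - x)" if y: "norm (y - x) < d'" for y
  proof -
    have "y \<in> S" using y d by (auto simp: d'_def dist_norm norm_minus_commute)
    have "c * norm (y - x) \<le> (\<bar>c\<bar> + 1) * (e / (\<bar>c\<bar> + 1))"
      using y by (intro mult_mono) (auto simp: d'_def)
    then have "c * norm (y - x) \<le> e" by simp
    then have "c * norm (y - x) * norm (y - x) \<le> e * norm (y - x)" by (intro mult_right_mono) auto
    then show ?thesis using rem[OF \<open>y \<in> S\<close>] by (simp add: power2_eq_square mult.assoc)
  qed
  ultimately show "\<exists>d>0. \<forall>y. norm (y - x) < d \<longrightarrow> norm (f y - f x - f' (y - x)) \<le> e * norm (y - x)"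
    by blast
qed

lemma circle_coeff_blinfun_linear:
  fixes A :: "complex \<Rightarrow> 'a::real_normed_vector \<Rightarrow>\<^sub>L complex"
  assumes "0 < r" "continuous_on (sphere 0 r) A" "\<And>w. norm w = r \<Longrightarrow> norm (A w) \<le> M"
  shows "bounded_linear (\<lambda>v. circle_coeff r n (\<lambda>w. A w v))"
proof (rule bounded_linear_intro[where K="M / r ^ n"])
  have c: "continuous_on (sphere 0 r) (\<lambda>w. A w v)" for v
    by (intro continuous_intros assms)
  show "circle_coeff r n (\<lambda>w. A w (x + y)) = circle_coeff r n (\<lambda>w. A w x) + circle_coeff r n (\<lambda>w. A w y)" for x y
    by (simp add: blinfun.add_right circle_coeff_add[OF assms(1) c c])
  show "circle_coeff r n (\<lambda>w. A w (a *\<^sub>R x)) = a *\<^sub>R circle_coeff r n (\<lambda>w. A w x)" for a x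
    by (simp add: blinfun.scaleR_right circle_coeff_scaleR)
  show "norm (circle_coeff r n (\<lambda>w. A w x)) \<le> norm x * (M / r ^ n)" for x
  proof -
    have "norm (circle_coeff r n (\<lambda>w. A w x)) \<le> (M * norm x) / r ^ n"
      by (intro norm_circle_coeff_le assms c) 
        (metis assms(3) mult_right_mono norm_blinfun norm_ge_zero order_trans)
    then show ?thesis by (simp add: mult.commute)
  qed
qed

text \<open>
  A sup bound on the coefficients is only available after a loss, since it comes from an average
  over balls of exponentially small radius; the gradient bounds, which hold with the worse rate
  1/r, make up for that loss, and a second interpolation with the Lipschitz bound of the gradient
  gives a rate better than 1/r for the gradients too.
\<close>

lemma coefficient_interpolation:
  fixes u :: "'a::euclidean_space \<Rightarrow> complex \<Rightarrow> complex"
    and Du :: "'a \<Rightarrow> complex \<Rightarrow> 'a \<Rightarrow>\<^sub>L complex"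
  assumes r: "0 < r" and p: "0 < p" "p < 1" and R: "r \<le> R * p ^ (2 * DIM('a) + 2)" and "\<tau> > 0"
    and der: "\<And>h w. h \<in> ball 0 \<tau> \<Longrightarrow> norm w = r \<Longrightarrow> ((\<lambda>h. u h w) has_derivative Du h w) (at h)"
    and lip: "\<And>h k w. h \<in> ball 0 \<tau> \<Longrightarrow> k \<in> ball 0 \<tau> \<Longrightarrow> norm w = r \<Longrightarrow>
        norm (Du h w - Du k w) \<le> M * norm (h - k)"
    and bd: "\<And>h w. h \<in> ball 0 \<tau> \<Longrightarrow> norm w = r \<Longrightarrow> norm (Du h w) \<le> M"
    and cont: "\<And>h. h \<in> ball 0 \<tau> \<Longrightarrow> continuous_on (sphere 0 r) (u h)"
      "\<And>h. h \<in> ball 0 \<tau> \<Longrightarrow> continuous_on (sphere 0 r) (Du h)"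
    and small: "\<And>n h d. 0 < d \<Longrightarrow> ball h d \<subseteq> ball 0 \<tau> \<Longrightarrow>
        \<exists>h'\<in>ball h d. norm (circle_coeff r n (u h')) * R ^ n * d ^ DIM('a) \<le> C"
    and w0: "norm w0 < r / p"
  obtains H H' where "\<And>h. h \<in> ball 0 (\<tau>/4) \<Longrightarrow> (H has_derivative blinfun_apply (H' h)) (at h)"
    "continuous_on (ball 0 (\<tau>/4)) H'"
    "\<And>h. h \<in> ball 0 (\<tau>/4) \<Longrightarrow> (\<lambda>n. circle_coeff r n (u h) * w0 ^ n) sums H h"
proof -
  let ?m = "DIM('a)"
  define a where "a n h = circle_coeff r n (u h)" for n h
  \<comment> \<open>The future differential of \<open>a n\<close> at h: the average of Du instead of
    u.\<close>
  define b where "b n h v = circle_coeff r n (\<lambda>w. Du h w v)" for n h v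
  have M: "M \<ge> 0"
    using bd[of 0 "of_real r"] r \<open>\<tau> > 0\<close> by (simp add: order_trans[OF norm_ge_zero])
  have Rpos: "R > 0" using r R p by (smt (verit) zero_less_mult_pos2 zero_less_power)
  have cDu: "continuous_on (sphere 0 r) (\<lambda>w. Du h w v)" if "h \<in> ball 0 \<tau>" for h v
    by (intro continuous_intros cont that)
  have b_lin: "bounded_linear (b n h)" if "h \<in> ball 0 \<tau>" for n h
    unfolding b_def by (rule circle_coeff_blinfun_linear[where M=M]) (use r cont bd that in auto)
  have a_lip: "norm (a n h - a n k) \<le> M * norm (h - k) / r ^ n" if "h \<in> ball 0 \<tau>" "k \<in> ball 0 \<tau>" for n h k
    unfolding a_def circle_coeff_diff[OF r cont(1)[OF that(1)] cont(1)[OF that(2)], symmetric]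
  proof (intro norm_circle_coeff_le r continuous_intros cont that)
    fix w :: complex assume w: "norm w = r"
    show "norm (u h w - u k w) \<le> M * norm (h - k)"
      by (rule differentiable_bound[OF convex_ball[of 0 \<tau>], where f'="\<lambda>h. Du h w"])
        (use der w bd that in \<open>auto intro: has_derivative_at_withinI simp flip: norm_blinfun.rep_eq\<close>)
  qed
  have b_lip: "norm (b n h v - b n k v) \<le> M * norm (h - k) / r ^ n * norm v"
    if "h \<in> ball 0 \<tau>" "k \<in> ball 0 \<tau>" for n h k v
  proof -
    have "norm (circle_coeff r n (\<lambda>w. Du h w v - Du k w v)) \<le> (M * norm (h - k) * norm v) / r ^ n"
    proof (intro norm_circle_coeff_le r continuous_intros cont that)
      fix w :: complex assume w: "norm w = r"
      have "norm ((Du h w - Du k w) v) \<le> norm (Du h w - Du k w) * norm v" by (rule norm_blinfun)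
      also have "\<dots> \<le> M * norm (h - k) * norm v" by (intro mult_right_mono lip that w) auto
      finally show "norm (Du h w v - Du k w v) \<le> M * norm (h - k) * norm v" by (simp add: blinfun.diff_left)
    qed
    then show ?thesis unfolding b_def circle_coeff_diff[OF r cDu[OF that(1)] cDu[OF that(2)], symmetric] by simp
  qed
  \<comment> \<open>The Lipschitz bound on Du makes the Taylor remainder of u quadratic with the
    same M at every point of the circle. The estimate serves twice: for differentiability of
    \<open>a n\<close>, and for the bound on its gradient.\<close>
  have taylor: "norm (a n k - a n h - b n h (k - h)) \<le> M / r ^ n * (norm (k - h))\<^sup>2" 
    if h: "h \<in> ball 0 \<tau>" and k: "k \<in> ball 0 \<tau>" for n h k
  proof -
    have cont': "continuous_on (sphere 0 r) (\<lambda>w. u k w - u h w)" by (intro continuous_intros cont h k)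
    have "norm (circle_coeff r n (\<lambda>w. (u k w - u h w) - Du h w (k - h))) \<le> M * (norm (k - h))\<^sup>2 / r ^ n"
    proof (intro norm_circle_coeff_le r continuous_intros cont h k)
      fix w :: complex assume w: "norm w = r"
      have seg: "closed_segment h k \<subseteq> ball 0 \<tau>" using h k closed_segment_subset convex_ball by blast
      have "norm (u k w - u h w - Du h w (k - h)) \<le> norm (k - h) * (M * norm (k - h))"
      proof (rule differentiable_bound_linearization[where S="closed_segment h k" and f'="\<lambda>h. Du h w"])
        show "h + t *\<^sub>R (k - h) \<in> closed_segment h k" if "t \<in> {0..1}" for t
          using that by (auto simp: in_segment algebra_simps)
        show "((\<lambda>h. u h w) has_derivative Du x w) (at x within closed_segment h k)" if "x \<in> closed_segment h k" for x
          by (rule has_derivative_at_withinI, rule der[OF _ w]) (use that seg in blast)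
        show "onorm (blinfun_apply (Du x w) - blinfun_apply (Du h w)) \<le> M * norm (k - h)" if x: "x \<in> closed_segment h k" for x
        proof -
          have "onorm (blinfun_apply (Du x w) - blinfun_apply (Du h w)) = norm (Du x w - Du h w)"
            by (simp add: norm_blinfun.rep_eq minus_blinfun.rep_eq fun_diff_def)
          also have "\<dots> \<le> M * norm (x - h)" using lip[OF _ h w] x seg by auto
          also have "\<dots> \<le> M * norm (k - h)" using M x 
            by (intro mult_left_mono) (metis segment_bound1)
          finally show ?thesis .
        qed
      qed auto
      then show "norm (u k w - u h w - Du h w (k - h)) \<le> M * (norm (k - h))\<^sup>2"
        by (simp add: power2_eq_square mult_ac)
    qed
    then show ?thesis
      unfolding a_def b_def using circle_coeff_diff[OF r cont' cDu[OF h]] circle_coeff_diff[OF r cont(1)[OF k] cont(1)[OF h]] by simp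
  qed
  have a_der: "(a n has_derivative b n h) (at h)" if "h \<in> ball 0 \<tau>" for n h
    by (rule has_derivative_of_quadratic_remainder[OF b_lin[OF that] open_ball that]) (use taylor that in blast)
  define C1 where "C1 = \<bar>C\<bar> * (2/\<tau>) ^ ?m + M * (\<tau>/2)"
  have C1: "C1 \<ge> 0" unfolding C1_def using M \<open>\<tau> > 0\<close> by auto
  have a_small: "norm (a n h) \<le> C1 * (p\<^sup>2 / r) ^ n" if h: "h \<in> ball 0 (\<tau>/2)" for n h
  proof -
    \<comment> \<open>Chosen so that both errors are of order (p^2/r)^n. Moving from h' to h costs M
      d / r^n. The average bound at h' loses d^(-m), of order p^(-2mn), and \<open>R\<close> pays
      for this: r^n is at most R^n p^(2mn) p^(2n). The two summands of \<open>C1\<close> are these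
      two errors.\<close>
    define d where "d = \<tau>/2 * (p\<^sup>2) ^ n"
    have d: "d > 0" "d \<le> \<tau>/2" unfolding d_def using \<open>\<tau> > 0\<close> p
      by (auto simp: power_le_one mult_le_cancel_left1)
    have sub: "ball h d \<subseteq> ball 0 \<tau>" using h d 
      by (smt (verit) dist_commute dist_triangle mem_ball subsetI field_sum_of_halves)
    obtain h' where h': "h' \<in> ball h d" "norm (a n h') * R ^ n * d ^ ?m \<le> C"
      using small[OF d(1) sub, of n] unfolding a_def by blast
    have "r ^ n \<le> (R * p ^ (2 * ?m + 2)) ^ n" using R r by (intro power_mono) auto
    also have "\<dots> = R ^ n * (((p\<^sup>2) ^ n) ^ ?m * (p\<^sup>2) ^ n)"
    proof -
      have e: "p ^ (2 * ?m + 2) = (p\<^sup>2) ^ ?m * p\<^sup>2" by (simp only: power_add power_mult)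
      have "((p\<^sup>2) ^ ?m) ^ n = ((p\<^sup>2) ^ n) ^ ?m" by (metis power_mult mult.commute)
      then show ?thesis unfolding e power_mult_distrib by simp
    qed
    finally have rn: "r ^ n \<le> R ^ n * (((p\<^sup>2) ^ n) ^ ?m * (p\<^sup>2) ^ n)" .
    have "norm (a n h') * r ^ n * (\<tau>/2) ^ ?m \<le> norm (a n h') * (R ^ n * (((p\<^sup>2) ^ n) ^ ?m * (p\<^sup>2) ^ n)) * (\<tau>/2) ^ ?m"
      by (intro mult_right_mono mult_left_mono rn) (use \<open>\<tau> > 0\<close> in auto)
    also have "\<dots> = norm (a n h') * R ^ n * d ^ ?m * (p\<^sup>2) ^ n" unfolding d_def power_mult_distrib by (simp add: mult_ac)
    also have "\<dots> \<le> \<bar>C\<bar> * (p\<^sup>2) ^ n" by (intro mult_right_mono) (use h' in auto)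
    finally have "norm (a n h') \<le> \<bar>C\<bar> * (p\<^sup>2) ^ n / (r ^ n * (\<tau>/2) ^ ?m)"
      using r \<open>\<tau> > 0\<close> by (subst pos_le_divide_eq) (auto simp: mult_ac)
    also have "\<dots> = \<bar>C\<bar> * (2/\<tau>) ^ ?m * (p\<^sup>2 / r) ^ n" by (simp add: power_divide mult_ac)
    finally have 1: "norm (a n h') \<le> \<bar>C\<bar> * (2/\<tau>) ^ ?m * (p\<^sup>2 / r) ^ n" .
    have hb: "h \<in> ball 0 \<tau>" "h' \<in> ball 0 \<tau>" using h' sub d(1) centre_in_ball[of h d] by blast+
    have "norm (a n h - a n h') \<le> M * norm (h - h') / r ^ n" by (rule a_lip[OF hb])
    also have "\<dots> \<le> M * d / r ^ n" using h'(1) r M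
      by (intro divide_right_mono mult_left_mono) (auto simp: dist_norm)
    also have "\<dots> = M * (\<tau>/2) * (p\<^sup>2 / r) ^ n" unfolding d_def by (simp add: power_divide)
    finally have 2: "norm (a n h - a n h') \<le> M * (\<tau>/2) * (p\<^sup>2 / r) ^ n" .
    have "norm (a n h) \<le> norm (a n h') + norm (a n h - a n h')" by (metis norm_triangle_sub)
    with 1 2 show ?thesis unfolding C1_def by (simp add: algebra_simps)
  qed
  define C2 where "C2 = (2 * C1 + M * (\<tau>/4)\<^sup>2) / (\<tau>/4)"
  have C2: "C2 \<ge> 0" unfolding C2_def using M C1 \<open>\<tau> > 0\<close> by auto
  have b_small: "norm (b n h v) \<le> C2 * (p / r) ^ n * norm v" if h: "h \<in> ball 0 (\<tau>/4)" for n h v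
  proof (cases "v = 0")
    case True
    have "h \<in> ball 0 \<tau>" using h \<open>\<tau> > 0\<close> unfolding mem_ball_0 by linarith
    then show ?thesis using True linear_0[OF bounded_linear.linear[OF b_lin]] by simp
  next
    case False
    \<comment> \<open>The values of \<open>a n\<close> and the remainder M s^2 / r^n are both of
      order (p^2/r)^n at this step length; dividing the difference quotient by s leaves (p/r)^n. The
      factor \<tau>/4 keeps k in the ball where \<open>a_small\<close> holds.\<close>
    define s where "s = \<tau>/4 * p ^ n"
    have s: "s > 0" "s \<le> \<tau>/4" unfolding s_def using \<open>\<tau> > 0\<close> p
      by (auto simp: power_le_one mult_le_cancel_left1)
    define k where "k = h + (s / norm v) *\<^sub>R v"
    have nk: "norm (k - h) = s" unfolding k_def using False s by simp
    have k: "k \<in> ball 0 (\<tau>/2)" using h nk s norm_triangle_sub[of k h] unfolding mem_ball_0 by linarith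
    have hb: "h \<in> ball 0 \<tau>" "k \<in> ball 0 \<tau>" "h \<in> ball 0 (\<tau>/2)" using h k \<open>\<tau> > 0\<close> unfolding mem_ball_0 by linarith+
    have "norm (b n h (k - h)) \<le> norm (a n k) + norm (a n h) + norm (a n k - a n h - b n h (k - h))"
      using norm_triangle_ineq4[of "a n k" "a n h"] norm_triangle_sub[of "b n h (k - h)" "a n k - a n h"]
      by (simp add: norm_minus_commute)
    also have "\<dots> \<le> C1 * (p\<^sup>2 / r) ^ n + C1 * (p\<^sup>2 / r) ^ n + M / r ^ n * s\<^sup>2"
      using a_small[OF k, of n] a_small[OF hb(3), of n] taylor[OF hb(1,2), of n] unfolding nk by simp
    also have "\<dots> = (2 * C1 + M * (\<tau>/4)\<^sup>2) * (p\<^sup>2 / r) ^ n"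
      unfolding s_def by (simp add: power_divide power_mult_distrib algebra_simps flip: power_mult)
    finally have le: "norm (b n h (k - h)) \<le> (2 * C1 + M * (\<tau>/4)\<^sup>2) * (p\<^sup>2 / r) ^ n" .
    have "b n h (k - h) = (s / norm v) *\<^sub>R b n h v"
      unfolding k_def using linear_scale[OF bounded_linear.linear[OF b_lin[OF hb(1)]]] by simp
    then have "norm (b n h v) = norm (b n h (k - h)) * norm v / s" using s False by simp
    also have "\<dots> \<le> (2 * C1 + M * (\<tau>/4)\<^sup>2) * (p\<^sup>2 / r) ^ n * norm v / s"
      by (intro divide_right_mono mult_right_mono le) (use s in auto)
    also have "\<dots> = C2 * (p / r) ^ n * norm v"
      unfolding s_def C2_def using p \<open>\<tau> > 0\<close> r by (simp add: power_divide power2_eq_square power_mult_distrib field_simps)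
    finally show ?thesis .
  qed
  \<comment> \<open>The differentials of the terms a_n(h) w0^n, taken as elements of the Banach
    space of bounded linear maps, so that the Weierstrass test gives a continuous sum of
    differentials.\<close>
  define B where "B n h = Blinfun (\<lambda>v. b n h v * w0 ^ n)" for n h
  have B: "blinfun_apply (B n h) = (\<lambda>v. b n h v * w0 ^ n)" if "h \<in> ball 0 \<tau>" for n h
    unfolding B_def by (intro bounded_linear_Blinfun_apply bounded_linear_mult_const b_lin that)
  \<comment> \<open>Ratio of the geometric majorant. It is below 1 exactly because |w0| < r/p; this
    is where the gain over r appears.\<close>
  define x where "x = p * norm w0 / r"
  have x: "0 \<le> x" "x < 1" unfolding x_def using w0 p r by (auto simp: field_simps)
  have quarter: "h \<in> ball 0 \<tau>" "h \<in> ball 0 (\<tau>/2)" if "h \<in> ball 0 (\<tau>/4)" for h :: 'a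
    using that \<open>\<tau> > 0\<close> unfolding mem_ball_0 by linarith+
  have B_small: "norm (B n h) \<le> C2 * x ^ n" if h: "h \<in> ball 0 (\<tau>/4)" for n h
  proof (rule norm_blinfun_bound)
    show "0 \<le> C2 * x ^ n" using C2 x by auto
    fix v
    have "norm (B n h v) \<le> (C2 * (p / r) ^ n * norm v) * norm w0 ^ n"
      unfolding B[OF quarter(1)[OF h]] norm_mult norm_power by (intro mult_right_mono b_small h) auto
    then show "norm (B n h v) \<le> C2 * x ^ n * norm v" unfolding x_def by (simp add: power_divide power_mult_distrib mult_ac)
  qed
  have B_cont: "continuous_on (ball 0 (\<tau>/4)) (B n)" for n
  proof (rule lipschitz_on_continuous_on, rule lipschitz_onI)
    show "0 \<le> M / r ^ n * norm w0 ^ n" using M r by auto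
    fix h k :: 'a assume hk: "h \<in> ball 0 (\<tau>/4)" "k \<in> ball 0 (\<tau>/4)"
    note hk' = quarter(1)[OF hk(1)] quarter(1)[OF hk(2)]
    have "norm (B n h - B n k) \<le> M / r ^ n * norm w0 ^ n * norm (h - k)"
    proof (rule norm_blinfun_bound)
      show "0 \<le> M / r ^ n * norm w0 ^ n * norm (h - k)" using M r by auto
      fix v
      have "norm ((B n h - B n k) v) = norm (b n h v - b n k v) * norm w0 ^ n"
        by (simp add: blinfun.diff_left B[OF hk'(1)] B[OF hk'(2)] norm_mult norm_power flip: left_diff_distrib)
      also have "\<dots> \<le> (M * norm (h - k) / r ^ n * norm v) * norm w0 ^ n"
        by (intro mult_right_mono b_lip hk') auto
      finally show "norm ((B n h - B n k) v) \<le> M / r ^ n * norm w0 ^ n * norm (h - k) * norm v"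
        by (simp add: mult_ac)
    qed
    then show "dist (B n h) (B n k) \<le> M / r ^ n * norm w0 ^ n * dist h k" by (simp add: dist_norm)
  qed
  have summ: "summable (\<lambda>n. c * x ^ n)" for c using x by (intro summable_mult summable_geometric) auto
  have unif: "uniform_limit (ball 0 (\<tau>/4)) (\<lambda>n h. \<Sum>i<n. B i h) (\<lambda>h. suminf (\<lambda>i. B i h)) sequentially"
    by (rule Weierstrass_m_test[OF B_small summ])
  have cont_lim: "continuous_on (ball 0 (\<tau>/4)) (\<lambda>h. suminf (\<lambda>i. B i h))"
    by (rule uniform_limit_theorem[OF _ unif]) (auto intro!: always_eventually continuous_intros B_cont)
  have sums0: "summable (\<lambda>n. a n h * w0 ^ n)" if h: "h \<in> ball 0 (\<tau>/4)" for h
  proof (rule summable_comparison_test[OF _ summ[of C1]], intro exI allI impI)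
    fix n
    have "norm (a n h * w0 ^ n) \<le> C1 * (p\<^sup>2 / r) ^ n * norm w0 ^ n"
      unfolding norm_mult norm_power by (intro mult_right_mono a_small quarter h) auto
    also have "\<dots> \<le> C1 * (p / r) ^ n * norm w0 ^ n"
    proof (intro mult_right_mono mult_left_mono power_mono divide_right_mono C1)
      show "p\<^sup>2 \<le> p" using p by (simp add: power2_eq_square mult_le_cancel_left1)
    qed (use p r in auto)
    finally show "norm (a n h * w0 ^ n) \<le> C1 * x ^ n" unfolding x_def by (simp add: power_divide power_mult_distrib mult_ac)
  qed
  have z: "0 \<in> ball (0::'a) (\<tau>/4)" using \<open>\<tau> > 0\<close> by simp
  have "\<exists>g. \<forall>h\<in>ball 0 (\<tau>/4). (\<lambda>n. a n h * w0 ^ n) sums g h \<and>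
      (g has_derivative blinfun_apply (suminf (\<lambda>i. B i h))) (at h within ball 0 (\<tau>/4))"
  proof (rule has_derivative_series[OF convex_ball _ _ z])
    show "((\<lambda>h. a n h * w0 ^ n) has_derivative blinfun_apply (B n h)) (at h within ball 0 (\<tau>/4))" 
      if "h \<in> ball 0 (\<tau>/4)" for n h
      unfolding B[OF quarter(1)[OF that]]
      using has_derivative_mult_left[OF a_der[OF quarter(1)[OF that]], of n "w0 ^ n"] by (rule has_derivative_at_withinI)
    show "(\<lambda>n. a n 0 * w0 ^ n) sums suminf (\<lambda>n. a n 0 * w0 ^ n)" using sums0[OF z] by (rule summable_sums)
    fix e :: real assume "e > 0"
    from uniform_limitD[OF unif this]
    show "\<forall>\<^sub>F n in sequentially. \<forall>x\<in>ball 0 (\<tau>/4). \<forall>h. norm ((\<Sum>i<n. B i x h) - (\<Sum>i. B i x) h) \<le> e * norm h"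
    proof eventually_elim
      case (elim n)
      show ?case
      proof (intro ballI allI)
        fix x h :: 'a assume "x \<in> ball 0 (\<tau>/4)"
        then have "norm ((\<Sum>i<n. B i x) - (\<Sum>i. B i x)) \<le> e" using elim by (force simp: dist_norm)
        then have "norm (((\<Sum>i<n. B i x) - (\<Sum>i. B i x)) h) \<le> e * norm h"
          by (meson mult_right_mono norm_blinfun norm_ge_zero order_trans)
        then show "norm ((\<Sum>i<n. B i x h) - (\<Sum>i. B i x) h) \<le> e * norm h"
          by (simp add: blinfun.diff_left blinfun.sum_left)
      qed
    qed
  qed
  then obtain g where g: "\<And>h. h \<in> ball 0 (\<tau>/4) \<Longrightarrow> (\<lambda>n. a n h * w0 ^ n) sums g h"
      "\<And>h. h \<in> ball 0 (\<tau>/4) \<Longrightarrow> (g has_derivative blinfun_apply (suminf (\<lambda>i. B i h))) (at h within ball 0 (\<tau>/4))"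
    by blast
  show thesis
  proof (rule that[of g "\<lambda>h. suminf (\<lambda>i. B i h)"])
    show "(g has_derivative blinfun_apply (suminf (\<lambda>i. B i h))) (at h)" if "h \<in> ball 0 (\<tau>/4)" for h
      using g(2)[OF that] that by (simp add: at_within_open[OF that open_ball])
  qed (use cont_lim g(1) in \<open>auto simp: a_def\<close>)
qed

text \<open>
  Averaging over all translates by h, including those along the disc itself, means that only
  translation invariance of Lebesgue measure enters and no coordinates have to be split off.
\<close>

lemma exists_small_of_nn_integral_circle:
  fixes G :: "'a::euclidean_space \<Rightarrow> ennreal" and \<iota> :: "complex \<Rightarrow> 'a" and a :: "nat \<Rightarrow> 'a \<Rightarrow> complex"
  assumes G: "G \<in> borel_measurable borel" and fin: "(\<integral>\<^sup>+x. G x \<partial>lborel) < \<infinity>"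
    and \<iota>: "continuous_on UNIV \<iota>" and N: "negligible N"
    and bound: "\<And>n h. h \<in> ball 0 \<tau> \<Longrightarrow> h \<notin> N \<Longrightarrow>
      ennreal (norm (a n h) * R ^ n) \<le> (\<integral>\<^sup>+t\<in>{0..1}. G (x0 + h + \<iota> (circlepath 0 R t)) \<partial>lborel)"
  shows "\<exists>C. \<forall>n h d. 0 < d \<longrightarrow> ball h d \<subseteq> ball 0 \<tau> \<longrightarrow> (\<exists>h'\<in>ball h d. norm (a n h') * R ^ n * d ^ DIM('a) \<le> C)"
proof -
  define J where "J = (\<integral>\<^sup>+x. G x \<partial>lborel)"
  define c where "c t = \<iota> (circlepath 0 R t)" for t
  have c_cont: "continuous_on UNIV c" unfolding c_def
    by (rule continuous_on_compose2[OF \<iota> continuous_on_circlepath_0]) auto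
  define I where "I h = (\<integral>\<^sup>+t\<in>{0..1}. G (x0 + h + c t) \<partial>lborel)" for h
  have meas: "(\<lambda>p. x0 + snd p + c (fst p)) \<in> borel_measurable borel"
    by (intro borel_measurable_continuous_onI continuous_intros continuous_on_compose2[OF c_cont]) auto
  have meas2: "(\<lambda>p::real \<times> 'a. G (x0 + snd p + c (fst p)) * indicator {0..1} (fst p)) \<in> borel_measurable (lborel \<Otimes>\<^sub>M lborel)"
  proof -
    have "(indicator {0..1} :: real \<Rightarrow> ennreal) \<in> borel_measurable borel" by simp
    moreover have "fst \<in> measurable (borel :: (real \<times> 'a) measure) borel"
      by (intro borel_measurable_continuous_onI continuous_on_fst continuous_on_id)
    ultimately have "(\<lambda>p::real \<times> 'a. indicator {0..1} (fst p) :: ennreal) \<in> borel_measurable borel"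
      by (rule measurable_compose[rotated])
    then show ?thesis
      unfolding lborel_prod measurable_lborel2
      by (intro borel_measurable_times_ennreal measurable_compose[OF meas G])
  qed
  have psf: "pair_sigma_finite (lborel :: real measure) (lborel :: 'a measure)"
    by (intro pair_sigma_finite.intro sigma_finite_lborel)
  have "(\<integral>\<^sup>+h. I h \<partial>lborel) = (\<integral>\<^sup>+t. \<integral>\<^sup>+h. G (x0 + h + c t) * indicator {0..1} t \<partial>lborel \<partial>lborel)"
    unfolding I_def using pair_sigma_finite.Fubini[OF psf meas2] by simp
  also have "\<dots> = (\<integral>\<^sup>+t. J * indicator {0..1} t \<partial>(lborel :: real measure))"
  proof (intro nn_integral_cong)
    fix t :: real
    have Gc: "(\<lambda>h. G (x0 + h + c t)) \<in> borel_measurable lborel"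
      by (rule measurable_compose[OF _ G]) (simp add: borel_measurable_continuous_onI continuous_intros)
    have "(\<integral>\<^sup>+h. G (x0 + h + c t) * indicator {0..1} t \<partial>lborel) = (\<integral>\<^sup>+h. G ((x0 + c t) + h) \<partial>lborel) * indicator {0..1} t"
      using Gc by (simp add: nn_integral_multc add_ac)
    also have "(\<integral>\<^sup>+h. G ((x0 + c t) + h) \<partial>lborel) = (\<integral>\<^sup>+h. G h \<partial>distr lborel borel ((+) (x0 + c t)))"
      by (rule nn_integral_distr[symmetric]) (use G in auto)
    finally show "(\<integral>\<^sup>+h. G (x0 + h + c t) * indicator {0..1} t \<partial>lborel) = J * indicator {0..1} t"
      by (simp add: lborel_distr_plus J_def)
  qed
  also have "\<dots> = J" by (simp add: nn_integral_cmult_indicator)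
  finally have I_int: "(\<integral>\<^sup>+h. I h \<partial>lborel) = J" .
  define v where "v = unit_ball_vol (real DIM('a))"
  have v: "v > 0" unfolding v_def by (rule unit_ball_vol_pos) simp
  \<comment> \<open>If the bound failed throughout a ball of radius d, then I would be at least C /
    d^m almost everywhere on it, and its integral at least C v = J + 1, although it is J.\<close>
  define C where "C = (enn2real J + 1) / v"
  have C: "C \<ge> 0" unfolding C_def using v by auto
  show ?thesis
  proof (intro exI[of _ C] allI impI)
    fix n and h :: 'a and d :: real assume d: "0 < d" and sub: "ball h d \<subseteq> ball 0 \<tau>"
    show "\<exists>h'\<in>ball h d. norm (a n h') * R ^ n * d ^ DIM('a) \<le> C"
    proof (rule ccontr)
      assume neg: "\<not> ?thesis"
      have low: "ennreal (C / d ^ DIM('a)) \<le> I k" if k: "k \<in> ball h d" "k \<notin> N" for k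
      proof -
        have "C \<le> norm (a n k) * R ^ n * d ^ DIM('a)" using neg k by force
        then have "C / d ^ DIM('a) \<le> norm (a n k) * R ^ n" using d by (simp add: field_simps)
        then have "ennreal (C / d ^ DIM('a)) \<le> ennreal (norm (a n k) * R ^ n)" by (rule ennreal_leI)
        also have "\<dots> \<le> I k" unfolding I_def c_def using bound k sub by blast
        finally show ?thesis .
      qed
      have "AE k in lborel. k \<notin> N"
        using AE_not_in[OF N[unfolded negligible_iff_null_sets]] by (simp only: AE_completion_iff)
      then have ae: "AE k in lborel. ennreal (C / d ^ DIM('a)) * indicator (ball h d) k \<le> I k"
        by eventually_elim (use low in \<open>auto simp: indicator_def\<close>)
      have "ennreal (enn2real J + 1) = ennreal (C / d ^ DIM('a)) * ennreal (v * d ^ DIM('a))"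
        using C v d unfolding C_def by (simp flip: ennreal_mult')
      also have "\<dots> = ennreal (C / d ^ DIM('a)) * emeasure lborel (ball h d)"
        using d by (simp add: emeasure_ball v_def)
      also have "\<dots> = (\<integral>\<^sup>+k. ennreal (C / d ^ DIM('a)) * indicator (ball h d) k \<partial>lborel)"
        by (simp add: nn_integral_cmult_indicator)
      also have "\<dots> \<le> J" unfolding I_int[symmetric] by (rule nn_integral_mono_AE[OF ae])
      also have "J = ennreal (enn2real J)" using fin by (simp add: J_def)
      finally show False by (simp add: ennreal_le_iff)
    qed
  qed
qed

subsection \<open>Holomorphic functions of several variables\<close>

lemma norm_vector_scalar_mult: "norm (c *s v) = norm c * norm (v :: complex ^ 'n)"
  by (simp add: norm_vec_def vector_scalar_mult_def norm_mult L2_set_right_distrib)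

lemma bounded_linear_vector_scalar_mult_left: "bounded_linear (\<lambda>c. c *s (v :: complex ^ 'n))"
  unfolding linear_conv_bounded_linear[symmetric]
  by (rule linearI) (simp_all add: vec_eq_iff distrib_right)

lemma holo_on_subset: "holo_on S f \<Longrightarrow> T \<subseteq> S \<Longrightarrow> holo_on T f"
  unfolding holo_on_def by blast

lemma holo_on_imp_continuous_on: "holo_on S f \<Longrightarrow> continuous_on S f"
  unfolding holo_on_def continuous_on_eq_continuous_within
  by (meson continuous_at_imp_continuous_at_within has_derivative_continuous)

lemma holo_on_line_holomorphic:
  assumes "holo_on S G"
  shows "(\<lambda>w. G (z + w *s v)) holomorphic_on {w. z + w *s v \<in> S}"
proof (rule holomorphic_onI)
  fix w assume "w \<in> {w. z + w *s v \<in> S}"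
  then obtain f' where f': "(G has_derivative f') (at (z + w *s v))" "\<And>c v. f' (c *s v) = c * f' v"
    using assms unfolding holo_on_def by blast
  have "((\<lambda>w. z + w *s v) has_derivative (\<lambda>h. h *s v)) (at w)"
    using has_derivative_add[OF has_derivative_const bounded_linear_imp_has_derivative[OF bounded_linear_vector_scalar_mult_left]]
    by auto
  from has_derivative_compose[OF this f'(1)]
  have "((\<lambda>w. G (z + w *s v)) has_field_derivative f' v) (at w)"
    unfolding has_field_derivative_def f'(2) by (simp add: mult.commute[of _ "f' v"])
  then show "(\<lambda>w. G (z + w *s v)) field_differentiable at w within {w. z + w *s v \<in> S}"
    unfolding field_differentiable_def by (blast intro: has_field_derivative_at_within)
qed

text \<open>On the complex line through z in direction v this is the one-variable Cauchy inequality
  for a disc of radius \<epsilon>.\<close>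

lemma holo_on_Cauchy_estimate:
  assumes G: "holo_on S G" and "cball z \<epsilon> \<subseteq> S" "\<epsilon> > 0"
    and B: "\<And>y. y \<in> cball z \<epsilon> \<Longrightarrow> norm (G y) \<le> B" and D: "(G has_derivative D) (at z)"
  shows "norm (D v) \<le> B / \<epsilon> * norm v"
proof (cases "v = 0")
  case True
  then show ?thesis using linear_0[OF has_derivative_linear[OF D]] by simp
next
  case False
  define v' where "v' = (1 / norm v) *\<^sub>R v"
  have nv': "norm v' = 1" using False by (simp add: v'_def)
  define u where "u w = G (z + w *s v')" for w
  have in_cball: "z + w *s v' \<in> cball z \<epsilon>" if "w \<in> cball 0 \<epsilon>" for w
    using that by (simp add: dist_norm norm_vector_scalar_mult nv')
  have u: "u holomorphic_on cball 0 \<epsilon>" unfolding u_def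
    by (rule holomorphic_on_subset[OF holo_on_line_holomorphic[OF G]]) (use in_cball assms(2) in blast)
  have "cmod ((deriv ^^ 1) u 0) \<le> fact 1 * B / \<epsilon> ^ 1"
  proof (rule Cauchy_inequality)
    show "u holomorphic_on ball 0 \<epsilon>" using u ball_subset_cball holomorphic_on_subset by blast
    show "continuous_on (cball 0 \<epsilon>) u" using u by (rule holomorphic_on_imp_continuous_on)
    show "cmod (u x) \<le> B" if "cmod (0 - x) = \<epsilon>" for x unfolding u_def using that by (intro B in_cball) auto
  qed fact
  moreover have "deriv u 0 = D v'"
  proof -
    obtain f' where f': "(G has_derivative f') (at z)" "\<And>c v. f' (c *s v) = c * f' v"
      using G assms unfolding holo_on_def by (meson centre_in_cball less_imp_le subsetD)
    then have "f' = D" using D has_derivative_unique by blast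
    have "((\<lambda>w. z + w *s v') has_derivative (\<lambda>h. h *s v')) (at 0)"
      using has_derivative_add[OF has_derivative_const bounded_linear_imp_has_derivative[OF bounded_linear_vector_scalar_mult_left]]
      by auto
    from has_derivative_compose[OF this, of G f'] f' 
    have "(u has_field_derivative f' v') (at 0)"
      unfolding has_field_derivative_def f'(2) u_def by (simp add: mult.commute[of _ "f' v'"])
    then show ?thesis unfolding \<open>f' = D\<close> by (rule DERIV_imp_deriv)
  qed
  ultimately have "norm (D v') \<le> B / \<epsilon>" by simp
  moreover have "D v = norm v *\<^sub>R D v'"
    unfolding v'_def using linear_scale[OF has_derivative_linear[OF D], of "norm v" "(1 / norm v) *\<^sub>R v"] False by simp
  ultimately show ?thesis using mult_left_mono[of "norm (D v')" "B / \<epsilon>" "norm v"] by (simp add: mult.commute)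
qed

text \<open>A second-order bound without second derivatives: the Cauchy estimate is applied to the
  difference G(x + k) - G(x), which is itself O(|k|), and whose differential at z is DG y - DG z
  when k = y - z.\<close>

lemma holo_on_locally_Lipschitz_derivative:
  assumes G: "holo_on S G" and S: "open S" "z0 \<in> S"
  obtains \<epsilon> L DG where "\<epsilon> > 0" "ball z0 \<epsilon> \<subseteq> S"
    "\<And>z. z \<in> ball z0 \<epsilon> \<Longrightarrow> (G has_derivative blinfun_apply (DG z)) (at z)"
    "\<And>z y. z \<in> ball z0 \<epsilon> \<Longrightarrow> y \<in> ball z0 \<epsilon> \<Longrightarrow> norm (DG z - DG y) \<le> L * norm (z - y)"
proof -
  obtain e where e: "e > 0" "cball z0 e \<subseteq> S" using S open_contains_cball by blast
  \<comment> \<open>Room for nested balls: G is bounded at radius 4 \<epsilon>, hence DG is bounded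
    and G Lipschitz at 3 \<epsilon>. This contains the closed \<epsilon>-ball about any z in the
    innermost ball, and also its translate by k.\<close>
  define \<epsilon> where "\<epsilon> = e / 4"
  have \<epsilon>: "\<epsilon> > 0" "cball z0 (4 * \<epsilon>) \<subseteq> S" using e unfolding \<epsilon>_def by auto
  have "compact (G ` cball z0 (4 * \<epsilon>))"
    by (intro compact_continuous_image holo_on_imp_continuous_on holo_on_subset[OF G] \<epsilon>) auto
  then obtain B where B: "\<And>y. y \<in> cball z0 (4 * \<epsilon>) \<Longrightarrow> norm (G y) \<le> B"
    using compact_imp_bounded bounded_iff by (metis imageI)
  have "\<forall>z\<in>S. \<exists>D. (G has_derivative blinfun_apply D) (at z)"
    using G unfolding holo_on_def by (metis bounded_linear_Blinfun_apply has_derivative_bounded_linear)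
  then obtain DG where DG: "\<And>z. z \<in> S \<Longrightarrow> (G has_derivative blinfun_apply (DG z)) (at z)" by metis
  have tri: "cball z \<epsilon> \<subseteq> cball z0 (s + \<epsilon>)" if "z \<in> cball z0 s" for z s
    using that by (smt (verit) dist_triangle mem_cball subsetI)
  have sub: "cball z0 s \<subseteq> S" if "s \<le> 4 * \<epsilon>" for s
    using that \<epsilon> by (meson dual_order.trans subset_cball)
  have DG_bound: "norm (DG z) \<le> B / \<epsilon>" if z: "z \<in> cball z0 (3 * \<epsilon>)" for z
  proof (rule norm_blinfun_bound)
    have zc: "cball z \<epsilon> \<subseteq> cball z0 (4 * \<epsilon>)" using tri[OF z] by simp
    have "B \<ge> 0" using B[of z0] \<epsilon> by (auto intro: order_trans[OF norm_ge_zero])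
    then show "0 \<le> B / \<epsilon>" using \<epsilon> by simp
    show "norm (DG z v) \<le> B / \<epsilon> * norm v" for v
      by (rule holo_on_Cauchy_estimate[OF G _ \<epsilon>(1) _ DG])
        (use zc \<epsilon> B z sub[of "3 * \<epsilon>"] in auto)
  qed
  have G_lip: "norm (G x - G y) \<le> B / \<epsilon> * norm (x - y)" 
    if "x \<in> cball z0 (3 * \<epsilon>)" "y \<in> cball z0 (3 * \<epsilon>)" for x y
    by (rule differentiable_bound[OF convex_cball[of z0 "3 * \<epsilon>"], where f'="\<lambda>x. blinfun_apply (DG x)"])
      (use that DG_bound sub[of "3 * \<epsilon>"] \<epsilon> in \<open>auto intro!: has_derivative_at_withinI DG simp flip: norm_blinfun.rep_eq\<close>)
  show thesis
  proof (rule that[OF \<epsilon>(1), of DG "B / \<epsilon> / \<epsilon>"])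
    show "ball z0 \<epsilon> \<subseteq> S" using sub[of \<epsilon>] \<epsilon>(1) ball_subset_cball by fastforce
    then show "(G has_derivative blinfun_apply (DG z)) (at z)" if "z \<in> ball z0 \<epsilon>" for z using DG that by blast
    fix z y assume z: "z \<in> ball z0 \<epsilon>" and y: "y \<in> ball z0 \<epsilon>"
    then have zS: "z \<in> S" "y \<in> S" using \<open>ball z0 \<epsilon> \<subseteq> S\<close> by auto
    define k where "k = y - z"
    define F where "F x = G (x + k) - G x" for x
    have sh: "x \<in> cball z0 (2 * \<epsilon>)" "x + k \<in> cball z0 (3 * \<epsilon>)" if "x \<in> cball z \<epsilon>" for x
    proof -
      show *: "x \<in> cball z0 (2 * \<epsilon>)" using tri[of z \<epsilon>] z that by auto
      have "dist x (x + k) = dist z y" unfolding k_def by (simp add: dist_norm norm_minus_commute)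
      moreover have "dist z0 (x + k) \<le> dist z0 z + dist z x + dist x (x + k)" 
        by (smt (verit) dist_triangle)
      moreover have "dist z0 (x + k) \<le> dist z0 y + dist y (x + k)" by (rule dist_triangle)
      moreover have "dist y (x + k) = dist z x" unfolding k_def by (simp add: dist_norm norm_minus_commute algebra_simps)
      ultimately show "x + k \<in> cball z0 (3 * \<epsilon>)" using y that \<epsilon>(1) by (simp del: dist_triangle)
    qed
    have F: "holo_on {x. x \<in> S \<and> x + k \<in> S} F"
      unfolding holo_on_def
    proof
      fix x assume "x \<in> {x. x \<in> S \<and> x + k \<in> S}"
      then obtain f' g' where f': "(G has_derivative f') (at x)" "\<And>c v. f' (c *s v) = c * f' v"
        and g': "(G has_derivative g') (at (x + k))" "\<And>c v. g' (c *s v) = c * g' v"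
        using G unfolding holo_on_def by blast
      have "((\<lambda>x. x + k) has_derivative (\<lambda>h. h)) (at x)" by (auto intro!: derivative_eq_intros)
      from has_derivative_diff[OF has_derivative_compose[OF this g'(1)] f'(1)]
      show "\<exists>f'. (F has_derivative f') (at x) \<and> (\<forall>c v. f' (c *s v) = c * f' v)"
        unfolding F_def using f'(2) g'(2) by (intro exI[of _ "\<lambda>h. g' h - f' h"]) (simp add: right_diff_distrib)
    qed
    have DF: "(F has_derivative (\<lambda>v. DG y v - DG z v)) (at z)"
    proof -
      have "((\<lambda>x. x + k) has_derivative (\<lambda>h. h)) (at z)" by (auto intro!: derivative_eq_intros)
      moreover have "(G has_derivative DG y) (at (z + k))" unfolding k_def using DG zS by simp
      ultimately show ?thesis unfolding F_def
        by (intro has_derivative_diff has_derivative_compose[of "\<lambda>x. x + k" "\<lambda>h. h", where g=G] DG zS)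
    qed
    have "norm (DG y - DG z) \<le> (B / \<epsilon> * norm k) / \<epsilon>"
    proof (rule norm_blinfun_bound)
      have "B \<ge> 0" using B[of z0] \<epsilon> by (auto intro: order_trans[OF norm_ge_zero])
      then show "0 \<le> (B / \<epsilon> * norm k) / \<epsilon>" using \<epsilon> by simp
      fix v
      have "norm (DG y v - DG z v) \<le> (B / \<epsilon> * norm k) / \<epsilon> * norm v"
      proof (rule holo_on_Cauchy_estimate[OF F _ \<epsilon>(1) _ DF])
        show "cball z \<epsilon> \<subseteq> {x. x \<in> S \<and> x + k \<in> S}" 
          using sh sub[of "2 * \<epsilon>"] sub[of "3 * \<epsilon>"] \<epsilon>(1) by auto
        show "norm (F x) \<le> B / \<epsilon> * norm k" if "x \<in> cball z \<epsilon>" for x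
          unfolding F_def using G_lip[of "x + k" x] sh[OF that] \<epsilon>(1) by simp
      qed
      then show "norm ((DG y - DG z) v) \<le> (B / \<epsilon> * norm k) / \<epsilon> * norm v" by (simp add: blinfun.diff_left)
    qed
    then show "norm (DG z - DG y) \<le> B / \<epsilon> / \<epsilon> * norm (z - y)"
      unfolding k_def by (simp add: norm_minus_commute)
  qed
qed

subsection \<open>Enlarging the disc of extension\<close>

lemma axis_complex_eq: "axis j w = w *s axis j (1::complex)"
  by (simp add: vec_eq_iff axis_def)

lemma norm_axis_complex: "norm (axis j w :: complex ^ 'n) = norm w"
  by (subst axis_complex_eq) (simp add: norm_vector_scalar_mult norm_axis_1)

lemma bounded_linear_axis_complex: "bounded_linear (axis j :: complex \<Rightarrow> complex ^ 'n)"
  using bounded_linear_vector_scalar_mult_left[of "axis j 1"] axis_complex_eq[of j] by (metis (no_types, lifting) ext)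

lemma axis_complex_zero [simp]: "axis j 0 = (0 :: complex ^ 'n)"
  by (simp add: vec_eq_iff axis_def)

lemma axis_minus: "axis j (- w) = - (axis j w :: complex ^ 'n)"
  by (simp add: vec_eq_iff axis_def)

lemma continuous_on_axis_complex [continuous_intros]:
  "continuous_on S f \<Longrightarrow> continuous_on S (\<lambda>x. axis j (f x) :: complex ^ 'n)"
  using bounded_linear.continuous_on[OF bounded_linear_axis_complex] .

text \<open>
  W is where the extension g already exists, K the pulled-back exceptional set, a union of lines
  in direction j; the last assumption says that W is maximal.
\<close>

locale chart_extension =
  fixes j :: "'n::finite" and x1 :: "complex ^ 'n" and \<rho> :: real
    and K W :: "(complex ^ 'n) set" and g :: "complex ^ 'n \<Rightarrow> complex"
    and Dg :: "complex ^ 'n \<Rightarrow> (complex ^ 'n) \<Rightarrow>\<^sub>L complex"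
  assumes open_W: "open W" and W_subset: "W \<subseteq> ball x1 \<rho>" and off_K_subset: "ball x1 \<rho> - K \<subseteq> W"
    and open_off_K: "open (ball x1 \<rho> - K)" and negligible_K: "negligible K"
    and K_invariant: "\<And>x w. x \<in> ball x1 \<rho> \<Longrightarrow> x + axis j w \<in> ball x1 \<rho> \<Longrightarrow> x \<in> K \<Longrightarrow> x + axis j w \<in> K"
    and g_derivative: "\<And>x. x \<in> W \<Longrightarrow> (g has_derivative blinfun_apply (Dg x)) (at x)"
    and Dg_Lipschitz: "\<And>x. x \<in> W \<Longrightarrow> \<exists>\<epsilon>>0. \<exists>L. \<forall>y\<in>ball x \<epsilon>. \<forall>z\<in>ball x \<epsilon>. norm (Dg y - Dg z) \<le> L * norm (y - z)"
    and g_axis: "\<And>x w. x \<in> W \<Longrightarrow>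
        blinfun_apply (Dg x) (axis j w) = w * blinfun_apply (Dg x) (axis j 1)"
    and g_integrable: "(\<integral>\<^sup>+x\<in>ball x1 \<rho> - K. ennreal (norm (g x)) \<partial>lborel) < \<infinity>"
    and maximal: "\<And>V H H'. open V \<Longrightarrow> V \<subseteq> ball x1 \<rho> \<Longrightarrow>
        (\<And>x. x \<in> V \<Longrightarrow> (H has_derivative blinfun_apply (H' x)) (at x)) \<Longrightarrow>
        continuous_on V H' \<Longrightarrow> (\<And>x. x \<in> V - K \<Longrightarrow> H x = g x) \<Longrightarrow> V \<subseteq> W"
begin

lemma K_invariant_iff:
  assumes "x \<in> ball x1 \<rho>" "x + axis j w \<in> ball x1 \<rho>"
  shows "x + axis j w \<in> K \<longleftrightarrow> x \<in> K"
  using K_invariant[OF assms] K_invariant[of "x + axis j w" "- w"] assms by (auto simp: axis_minus)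

lemma continuous_on_g: "continuous_on W g"
  using g_derivative has_derivative_continuous
  unfolding continuous_on_eq_continuous_within
  by (meson continuous_at_imp_continuous_at_within)

lemma continuous_on_Dg: "continuous_on W Dg"
  unfolding continuous_on_eq_continuous_within
proof
  fix x assume x: "x \<in> W"
  obtain \<epsilon> L where \<epsilon>: "\<epsilon> > 0" "\<And>y z. y \<in> ball x \<epsilon> \<Longrightarrow> z \<in> ball x \<epsilon> \<Longrightarrow> norm (Dg y - Dg z) \<le> L * norm (y - z)"
    using Dg_Lipschitz[OF x] by blast
  have "continuous_on (ball x \<epsilon>) Dg"
  proof (rule lipschitz_on_continuous_on, rule lipschitz_onI)
    show "dist (Dg y) (Dg z) \<le> \<bar>L\<bar> * dist y z" if "y \<in> ball x \<epsilon>" "z \<in> ball x \<epsilon>" for y z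
      using \<epsilon>(2)[OF that] by (simp add: dist_norm) (smt (verit) mult_right_mono norm_ge_zero)
  qed auto
  then show "continuous (at x within W) Dg"
    using \<epsilon>(1) by (meson centre_in_ball continuous_at_imp_continuous_at_within continuous_on_eq_continuous_at open_ball)
qed

lemma g_holomorphic_on_line: "(\<lambda>w. g (x + axis j w)) holomorphic_on {w. x + axis j w \<in> W}"
proof (rule holomorphic_onI)
  fix w assume w: "w \<in> {w. x + axis j w \<in> W}"
  have "((\<lambda>w. x + axis j w) has_derivative axis j) (at w)"
    using has_derivative_add[OF has_derivative_const bounded_linear_imp_has_derivative[OF bounded_linear_axis_complex]]
    by auto
  from has_derivative_compose[OF this g_derivative]
  have "((\<lambda>w. g (x + axis j w)) has_derivative (\<lambda>h. Dg (x + axis j w) (axis j h))) (at w)"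
    using w by auto
  moreover have "(\<lambda>h. blinfun_apply (Dg (x + axis j w)) (axis j h)) = (*) (blinfun_apply (Dg (x + axis j w)) (axis j 1))"
    by (rule ext, subst g_axis) (use w in \<open>auto intro: mult.commute\<close>)
  ultimately have "((\<lambda>w. g (x + axis j w)) has_field_derivative Dg (x + axis j w) (axis j 1)) (at w)"
    unfolding has_field_derivative_def by simp
  then show "(\<lambda>w. g (x + axis j w)) field_differentiable at w within {w. x + axis j w \<in> W}"
    unfolding field_differentiable_def by (blast intro: has_field_derivative_at_within)
qed

text \<open>A Lebesgue number argument: finitely many balls of half size cover Q, and a \<tau> below
  all half radii puts q + h and q + k into one common full ball, where a single Lipschitz constant
  applies.\<close>

lemma uniform_tube:
  assumes Q: "compact Q" "Q \<subseteq> W"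
  obtains \<tau> M where "\<tau> > 0" "M \<ge> 0"
    "\<And>q h. q \<in> Q \<Longrightarrow> h \<in> ball 0 \<tau> \<Longrightarrow> q + h \<in> W"
    "\<And>q h. q \<in> Q \<Longrightarrow> h \<in> ball 0 \<tau> \<Longrightarrow> norm (Dg (q + h)) \<le> M"
    "\<And>q h k. q \<in> Q \<Longrightarrow> h \<in> ball 0 \<tau> \<Longrightarrow> k \<in> ball 0 \<tau> \<Longrightarrow> norm (Dg (q + h) - Dg (q + k)) \<le> M * norm (h - k)"
proof -
  have "\<forall>q\<in>W. \<exists>\<epsilon> L. \<epsilon> > 0 \<and> ball q \<epsilon> \<subseteq> W \<and> (\<forall>y\<in>ball q \<epsilon>. \<forall>z\<in>ball q \<epsilon>. norm (Dg y - Dg z) \<le> L * norm (y - z))"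
  proof
    fix q assume q: "q \<in> W"
    obtain \<epsilon> L where \<epsilon>: "\<epsilon> > 0" "\<And>y z. y \<in> ball q \<epsilon> \<Longrightarrow> z \<in> ball q \<epsilon> \<Longrightarrow> norm (Dg y - Dg z) \<le> L * norm (y - z)"
      using Dg_Lipschitz[OF q] by blast
    obtain \<epsilon>' where \<epsilon>': "\<epsilon>' > 0" "ball q \<epsilon>' \<subseteq> W" using open_W q open_contains_ball by blast
    show "\<exists>\<epsilon> L. \<epsilon> > 0 \<and> ball q \<epsilon> \<subseteq> W \<and> (\<forall>y\<in>ball q \<epsilon>. \<forall>z\<in>ball q \<epsilon>. norm (Dg y - Dg z) \<le> L * norm (y - z))"
      by (rule exI[of _ "min \<epsilon> \<epsilon>'"], rule exI[of _ L]) (use \<epsilon> \<epsilon>' in auto)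
  qed
  then obtain \<epsilon> L where \<epsilon>: "\<And>q. q \<in> W \<Longrightarrow> \<epsilon> q > 0" "\<And>q. q \<in> W \<Longrightarrow> ball q (\<epsilon> q) \<subseteq> W"
    and L: "\<And>q y z. q \<in> W \<Longrightarrow> y \<in> ball q (\<epsilon> q) \<Longrightarrow> z \<in> ball q (\<epsilon> q) \<Longrightarrow> norm (Dg y - Dg z) \<le> L q * norm (y - z)"
    by metis
  have "Q \<subseteq> (\<Union>q\<in>Q. ball q (\<epsilon> q / 2))" using \<epsilon> Q(2) by force
  then obtain F where F: "F \<subseteq> Q" "finite F" "Q \<subseteq> (\<Union>q\<in>F. ball q (\<epsilon> q / 2))"
    using compactE_image[OF Q(1), of Q "\<lambda>q. ball q (\<epsilon> q / 2)"] by auto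
  \<comment> \<open>The entry 1 keeps the minimum meaningful for empty F and gives \<tau> \<le> 1,
    which enters the bound on Dg.\<close>
  define \<tau> where "\<tau> = Min (insert 1 ((\<lambda>q. \<epsilon> q / 2) ` F))"
  have \<tau>: "\<tau> > 0" unfolding \<tau>_def using F(2) \<epsilon>(1) F(1) Q(2) by auto
  have \<tau>1: "\<tau> \<le> 1" unfolding \<tau>_def using F(2) by auto
  have \<tau>F: "\<tau> \<le> \<epsilon> q / 2" if "q \<in> F" for q unfolding \<tau>_def
    by (rule Min_le) (use F(2) that in auto)
  define M1 where "M1 = (\<Sum>q\<in>F. \<bar>L q\<bar>)"
  have M1: "M1 \<ge> 0" "\<And>q. q \<in> F \<Longrightarrow> L q \<le> M1" unfolding M1_def
    using F(2) member_le_sum[of _ F "\<lambda>q. \<bar>L q\<bar>"] by (auto intro: sum_nonneg order_trans[OF abs_ge_self])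
  have "compact (Dg ` Q)" using continuous_on_subset[OF continuous_on_Dg Q(2)] Q(1) by (rule compact_continuous_image)
  then obtain B where B: "\<And>q. q \<in> Q \<Longrightarrow> norm (Dg q) \<le> B"
    using compact_imp_bounded bounded_iff by (metis imageI)
  have ex: "\<exists>f\<in>F. \<forall>h\<in>ball 0 \<tau>. q + h \<in> ball f (\<epsilon> f)" if "q \<in> Q" for q
  proof -
    obtain f where f: "f \<in> F" "dist f q < \<epsilon> f / 2" using F(3) \<open>q \<in> Q\<close> by auto
    have "dist f (q + h) < \<epsilon> f" if "h \<in> ball 0 \<tau>" for h
    proof -
      have "dist f (q + h) \<le> dist f q + norm h" by (metis dist_triangle dist_norm add_diff_cancel_left' norm_minus_commute)
      then show ?thesis using f \<tau>F[OF f(1)] that unfolding mem_ball_0 by linarith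
    qed
    then show ?thesis by (intro bexI[OF _ f(1)] ballI) (simp only: mem_ball)
  qed
  have lip: "norm (Dg (q + h) - Dg (q + k)) \<le> M1 * norm (h - k)" if "q \<in> Q" "h \<in> ball 0 \<tau>" "k \<in> ball 0 \<tau>" for q h k
  proof -
    obtain f where f: "f \<in> F" "\<And>h. h \<in> ball 0 \<tau> \<Longrightarrow> q + h \<in> ball f (\<epsilon> f)" using ex \<open>q \<in> Q\<close> by blast
    have "norm (Dg (q + h) - Dg (q + k)) \<le> L f * norm (q + h - (q + k))"
      using L[of f "q + h" "q + k"] f that F(1) Q(2) by blast
    also have "\<dots> \<le> M1 * norm (h - k)" using M1(2)[OF f(1)] by (simp add: mult_right_mono)
    finally show ?thesis .
  qed
  show thesis
  proof (rule that[OF \<tau>, of "M1 + \<bar>B\<bar>"])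
    show "q + h \<in> W" if "q \<in> Q" "h \<in> ball 0 \<tau>" for q h using ex[OF that(1)] that(2) \<epsilon>(2) F(1) Q(2) by blast
    show "norm (Dg (q + h)) \<le> M1 + \<bar>B\<bar>" if "q \<in> Q" "h \<in> ball 0 \<tau>" for q h
    proof -
      have "norm (Dg (q + h) - Dg (q + 0)) \<le> M1 * norm (h - 0)" by (rule lip) (use that \<tau> in auto)
      also have "\<dots> \<le> M1 * 1" using that \<tau>1 M1(1) by (intro mult_left_mono) auto
      finally show ?thesis using B[OF that(1)] norm_triangle_sub[of "Dg (q + h)" "Dg q"] by simp
    qed
    show "norm (Dg (q + h) - Dg (q + k)) \<le> (M1 + \<bar>B\<bar>) * norm (h - k)"
      if "q \<in> Q" "h \<in> ball 0 \<tau>" "k \<in> ball 0 \<tau>" for q h k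
      using lip[OF that] by (simp add: distrib_right add_increasing2)
  qed (use M1 in auto)
qed

text \<open>The coefficients are read off the circle of radius r, where g is C^1 for all small h.
  For h off K the whole leaf disc of radius R avoids K, so the same coefficients equal averages over
  the circle of radius R and inherit the L^1 bound. Interpolation makes the Taylor series C^1 in h
  at w0, and maximality of W absorbs the neighbourhood thus reached.\<close>

lemma disc_step:
  assumes r: "0 < r" and p: "0 < p" "p < 1" and R: "r \<le> R * p ^ (2 * DIM(complex ^ 'n) + 2)"
    and discR: "\<And>w. norm w \<le> R \<Longrightarrow> x0 + axis j w \<in> ball x1 \<rho>"
    and discr: "\<And>w. norm w \<le> r \<Longrightarrow> x0 + axis j w \<in> W"
    and w0: "norm w0 < r / p"
  shows "x0 + axis j w0 \<in> W"
proof -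
  have R_pos: "R > 0" using r R p by (smt (verit) zero_less_mult_pos2 zero_less_power)
  \<comment> \<open>The gained radius never exceeds R, so w0 stays in the disc that is known to lie
    in the chart ball.\<close>
  have "r / p \<le> R * p ^ (2 * DIM(complex ^ 'n) + 1)" using R p by (simp add: field_simps)
  also have "\<dots> \<le> R * 1" using R_pos p by (intro mult_left_mono power_le_one) auto
  finally have w0R: "norm w0 < R" using w0 by simp
  define \<gamma> where "\<gamma> w = x0 + axis j w" for w
  have \<gamma>_cont: "continuous_on S \<gamma>" for S unfolding \<gamma>_def by (intro continuous_intros)
  have comp: "compact (\<gamma> ` cball 0 s)" for s using \<gamma>_cont compact_cball by (rule compact_continuous_image)
  obtain \<tau>1 M where \<tau>1: "\<tau>1 > 0" "M \<ge> 0"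
    "\<And>q h. q \<in> \<gamma> ` cball 0 r \<Longrightarrow> h \<in> ball 0 \<tau>1 \<Longrightarrow> q + h \<in> W"
    "\<And>q h. q \<in> \<gamma> ` cball 0 r \<Longrightarrow> h \<in> ball 0 \<tau>1 \<Longrightarrow> norm (Dg (q + h)) \<le> M"
    "\<And>q h k. q \<in> \<gamma> ` cball 0 r \<Longrightarrow> h \<in> ball 0 \<tau>1 \<Longrightarrow> k \<in> ball 0 \<tau>1 \<Longrightarrow> norm (Dg (q + h) - Dg (q + k)) \<le> M * norm (h - k)"
    by (rule uniform_tube[OF comp[of r]]) (use discr in \<open>auto simp: \<gamma>_def\<close>)
  obtain \<tau>2 where \<tau>2: "\<tau>2 > 0" "(\<Union>q\<in>\<gamma> ` cball 0 R. ball q \<tau>2) \<subseteq> ball x1 \<rho>"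
    by (rule compact_subset_open_imp_ball_epsilon_subset[OF comp[of R] open_ball, of x1 \<rho>])
      (use discR in \<open>auto simp: \<gamma>_def\<close>)
  define \<tau> where "\<tau> = min \<tau>1 \<tau>2"
  have \<tau>: "\<tau> > 0" "\<tau> \<le> \<tau>1" "\<tau> \<le> \<tau>2" unfolding \<tau>_def using \<tau>1 \<tau>2 by auto
  have inW: "x0 + h + axis j w \<in> W" if "h \<in> ball 0 \<tau>" "norm w \<le> r" for h w
    using \<tau>1(3)[of "\<gamma> w" h] that \<tau> by (auto simp: \<gamma>_def add_ac)
  have inB: "x0 + h + axis j w \<in> ball x1 \<rho>" if "h \<in> ball 0 \<tau>" "norm w \<le> R" for h w
  proof -
    have "x0 + h + axis j w \<in> ball (\<gamma> w) \<tau>2" using that \<tau> by (simp add: \<gamma>_def dist_norm)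
    then show ?thesis using \<tau>2(2) that(2) by (meson UN_I imageI mem_cball_0 subsetD)
  qed
  have offK: "x0 + h + axis j w \<notin> K" if "h \<in> ball 0 \<tau>" "x0 + h \<notin> K" "x0 + h + axis j w \<in> ball x1 \<rho>" for h w
    using K_invariant_iff[of "x0 + h" w] inB[of h 0] that R_pos by auto
  define u where "u h w = g (x0 + h + axis j w)" for h w
  define Du where "Du h w = Dg (x0 + h + axis j w)" for h w
  define S where "S h = {w. x0 + h + axis j w \<in> ball x1 \<rho>}" for h
  have S_open: "open (S h)" for h
  proof -
    have "open ((\<lambda>w. x0 + h + axis j w) -` ball x1 \<rho>)"
      by (intro open_vimage continuous_intros) auto
    then show ?thesis by (simp add: S_def vimage_def)
  qed
  have S_R: "cball 0 R \<subseteq> S h" if "h \<in> ball 0 \<tau>" for h using inB[OF that] by (auto simp: S_def)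
  have rR: "r \<le> R" 
  proof -
    have "r \<le> R * p ^ (2 * DIM(complex ^ 'n) + 2)" by (rule R)
    also have "\<dots> \<le> R * 1" using R_pos p by (intro mult_left_mono power_le_one) auto
    finally show ?thesis by simp
  qed
  have u_hol: "u h holomorphic_on S h" if "h \<in> ball 0 \<tau>" "x0 + h \<notin> K" for h
    unfolding u_def
    by (rule holomorphic_on_subset[OF g_holomorphic_on_line])
      (use offK[OF that] off_K_subset in \<open>auto simp: S_def\<close>)
  \<comment> \<open>Cutting |g| off outside the ball minus K gives a Borel function on the whole
    space, to which translation invariance applies.\<close>
  define G where "G x = ennreal (norm (g x)) * indicator (ball x1 \<rho> - K) x" for x
  have "(\<lambda>x. indicator (ball x1 \<rho> - K) x *\<^sub>R norm (g x)) \<in> borel_measurable borel"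
    by (rule borel_measurable_continuous_on_indicator)
      (use open_off_K continuous_on_subset[OF continuous_on_g off_K_subset] in \<open>auto intro!: continuous_intros\<close>)
  moreover have "G = (\<lambda>x. ennreal (indicator (ball x1 \<rho> - K) x *\<^sub>R norm (g x)))"
    unfolding G_def by (intro ext) (simp split: split_indicator)
  ultimately have G_meas: "G \<in> borel_measurable borel" by simp
  have neg: "negligible ((\<lambda>x. - x0 + x) ` K)" using negligible_K by (rule negligible_translation)
  have "\<exists>C. \<forall>n h d. 0 < d \<longrightarrow> ball h d \<subseteq> ball 0 \<tau> \<longrightarrow>
      (\<exists>h'\<in>ball h d. norm (circle_coeff r n (u h')) * R ^ n * d ^ DIM(complex ^ 'n) \<le> C)"
  proof (rule exists_small_of_nn_integral_circle[OF G_meas _ _ neg])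
    show "(\<integral>\<^sup>+x. G x \<partial>lborel) < \<infinity>" using g_integrable by (simp add: G_def)
    show "continuous_on UNIV (axis j :: complex \<Rightarrow> complex ^ 'n)" using continuous_on_axis_complex[OF continuous_on_id] by simp
    fix n and h :: "complex ^ 'n" assume h: "h \<in> ball 0 \<tau>" "h \<notin> (\<lambda>x. - x0 + x) ` K"
    have hK: "x0 + h \<notin> K"
    proof
      assume "x0 + h \<in> K"
      then have "- x0 + (x0 + h) \<in> (\<lambda>x. - x0 + x) ` K" by (rule imageI)
      then show False using h(2) by simp
    qed
    have eq: "circle_coeff r n (u h) = circle_coeff R n (u h)"
      using circle_coeff_eq_deriv[OF r S_open _ u_hol[OF h(1) hK]] circle_coeff_eq_deriv[OF R_pos S_open _ u_hol[OF h(1) hK]]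
        S_R[OF h(1)] rR subset_cball[of r R 0] by (metis subset_trans)
    have cR: "continuous_on (sphere 0 R) (u h)"
      by (rule holomorphic_on_imp_continuous_on[OF holomorphic_on_subset[OF u_hol[OF h(1) hK]]])
        (use S_R[OF h(1)] sphere_cball in blast)
    have "ennreal (norm (circle_coeff r n (u h)) * R ^ n) \<le> (\<integral>\<^sup>+t\<in>{0..1}. ennreal (norm (u h (circlepath 0 R t))) \<partial>lborel)"
      unfolding eq by (rule circle_coeff_le_nn_integral[OF R_pos cR])
    also have "\<dots> = (\<integral>\<^sup>+t\<in>{0..1}. G (x0 + h + axis j (circlepath 0 R t)) \<partial>lborel)"
    proof (intro nn_integral_cong)
      fix t
      have "x0 + h + axis j (circlepath 0 R t) \<in> ball x1 \<rho>"
        by (rule inB[OF h(1)]) (use norm_circlepath_0[of R t] R_pos in simp)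
      with offK[OF h(1) hK this] show "ennreal (norm (u h (circlepath 0 R t))) * indicator {0..1} t =
          G (x0 + h + axis j (circlepath 0 R t)) * indicator {0..1} t"
        by (simp add: u_def G_def)
    qed
    finally show "ennreal (norm (circle_coeff r n (u h)) * R ^ n) \<le>
        (\<integral>\<^sup>+t\<in>{0..1}. G (x0 + h + axis j (circlepath 0 R t)) \<partial>lborel)" .
  qed
  then obtain C where C: "\<And>n h d. 0 < d \<Longrightarrow> ball h d \<subseteq> ball 0 \<tau> \<Longrightarrow>
      \<exists>h'\<in>ball h d. norm (circle_coeff r n (u h')) * R ^ n * d ^ DIM(complex ^ 'n) \<le> C" by blast
  have comb: "x0 + h + axis j w = \<gamma> w + h" for h w by (simp add: \<gamma>_def)
  obtain H H' where H: "\<And>h. h \<in> ball 0 (\<tau>/4) \<Longrightarrow> (H has_derivative blinfun_apply (H' h)) (at h)"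
    "continuous_on (ball 0 (\<tau>/4)) H'"
    "\<And>h. h \<in> ball 0 (\<tau>/4) \<Longrightarrow> (\<lambda>n. circle_coeff r n (u h) * w0 ^ n) sums H h"
  proof (rule coefficient_interpolation[OF r p R \<tau>(1), of u Du M C w0])
    fix h :: "complex ^ 'n" assume h: "h \<in> ball 0 \<tau>"
    have img: "(\<lambda>w. x0 + h + axis j w) ` sphere 0 r \<subseteq> W" using inW[OF h] by auto
    show "continuous_on (sphere 0 r) (u h)" unfolding u_def
      by (rule continuous_on_compose2[OF continuous_on_g _ img]) (intro continuous_intros)
    show "continuous_on (sphere 0 r) (Du h)" unfolding Du_def
      by (rule continuous_on_compose2[OF continuous_on_Dg _ img]) (intro continuous_intros)
    fix w :: complex assume w: "norm w = r"
    show "norm (Du h w) \<le> M" unfolding Du_def comb by (rule \<tau>1(4)) (use h \<tau> w in auto)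
    have "((\<lambda>h. x0 + h + axis j w) has_derivative (\<lambda>k. k)) (at h)" by (auto intro!: derivative_eq_intros)
    from has_derivative_compose[OF this g_derivative[OF inW[OF h]]]
    show "((\<lambda>h. u h w) has_derivative blinfun_apply (Du h w)) (at h)" unfolding u_def Du_def using w by simp
    fix k :: "complex ^ 'n" assume k: "k \<in> ball 0 \<tau>"
    show "norm (Du h w - Du k w) \<le> M * norm (h - k)" unfolding Du_def comb by (rule \<tau>1(5)) (use h k \<tau> w in auto)
  qed (use C w0 in auto)
  define V where "V = ball (\<gamma> w0) (\<tau>/4)"
  have Vsub: "y - \<gamma> w0 \<in> ball 0 (\<tau>/4)" "y - \<gamma> w0 \<in> ball 0 \<tau>" if "y \<in> V" for y
  proof -
    show *: "y - \<gamma> w0 \<in> ball 0 (\<tau>/4)" using that unfolding V_def by (simp add: dist_norm norm_minus_commute)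
    show "y - \<gamma> w0 \<in> ball 0 \<tau>" using * \<tau>(1) unfolding mem_ball_0 by linarith
  qed
  have y_eq: "x0 + (y - \<gamma> w0) + axis j w0 = y" for y by (simp add: \<gamma>_def)
  have VB: "y \<in> ball x1 \<rho>" if "y \<in> V" for y
    using inB[OF Vsub(2)[OF that], of w0] w0R unfolding y_eq by simp
  have "V \<subseteq> W"
  proof (rule maximal[of V "\<lambda>y. H (y - \<gamma> w0)" "\<lambda>y. H' (y - \<gamma> w0)"])
    show "open V" by (simp add: V_def)
    show "V \<subseteq> ball x1 \<rho>" using VB by blast
    show "continuous_on V (\<lambda>y. H' (y - \<gamma> w0))"
      by (rule continuous_on_compose2[OF H(2)]) (use Vsub(1) in \<open>auto intro!: continuous_intros\<close>)
    show "((\<lambda>y. H (y - \<gamma> w0)) has_derivative blinfun_apply (H' (y - \<gamma> w0))) (at y)" if "y \<in> V" for y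
    proof -
      have "((\<lambda>y. y - \<gamma> w0) has_derivative (\<lambda>k. k)) (at y)" by (auto intro!: derivative_eq_intros)
      from has_derivative_compose[OF this H(1)[OF Vsub(1)[OF that]]] show ?thesis by simp
    qed
    show "H (y - \<gamma> w0) = g y" if y: "y \<in> V - K" for y
    proof -
      define h where "h = y - \<gamma> w0"
      have h: "h \<in> ball 0 (\<tau>/4)" "h \<in> ball 0 \<tau>" unfolding h_def using Vsub y by auto
      have hB: "x0 + h \<in> ball x1 \<rho>" using inB[OF h(2), of 0] R_pos by simp
      have hK: "x0 + h \<notin> K"
        using K_invariant_iff[OF hB, of w0] VB[of y] y y_eq[of y] unfolding h_def by auto
      \<comment> \<open>Off K the leaf function is holomorphic on the full disc of radius R, so its
        Taylor series represents g at w0 even if |w0| > r; this identifies H with g there.\<close>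
      have "(\<lambda>n. (deriv ^^ n) (u h) 0 / fact n * (w0 - 0) ^ n) sums u h w0"
        by (rule holomorphic_power_series[of _ _ R])
          (use holomorphic_on_subset[OF u_hol[OF h(2) hK] order_trans[OF ball_subset_cball S_R[OF h(2)]]] w0R in auto)
      moreover have "(deriv ^^ n) (u h) 0 / fact n = circle_coeff r n (u h)" for n
        by (rule circle_coeff_eq_deriv[OF r S_open _ u_hol[OF h(2) hK], symmetric])
          (use S_R[OF h(2)] rR subset_cball in blast)
      ultimately have "(\<lambda>n. circle_coeff r n (u h) * w0 ^ n) sums u h w0" by simp
      then have "H h = u h w0" using H(3)[OF h(1)] sums_unique2 by blast
      then show ?thesis unfolding u_def h_def y_eq .
    qed
  qed
  then show ?thesis using \<tau>(1) by (auto simp: V_def \<gamma>_def)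
qed

text \<open>Take the supremum s of the radii below R whose closed discs lie in W. If a point w1 were
  missed, s would be at most |w1| < R, and a step starting just below s, with a p depending only on
  s/R, would carry beyond s.\<close>

lemma disc_extension:
  assumes x0: "x0 \<in> W" and discR: "\<And>w. norm w \<le> R \<Longrightarrow> x0 + axis j w \<in> ball x1 \<rho>" and w1: "norm w1 < R"
  shows "x0 + axis j w1 \<in> W"
proof (rule ccontr)
  assume bad: "x0 + axis j w1 \<notin> W"
  define T where "T = {r. 0 < r \<and> r < R \<and> (\<forall>w. norm w \<le> r \<longrightarrow> x0 + axis j w \<in> W)}"
  obtain e where e: "e > 0" "cball x0 e \<subseteq> W" using open_W x0 open_contains_cball by blast
  have R: "R > 0" using w1 norm_ge_zero by (rule le_less_trans[rotated])
  have "min e (R/2) \<in> T" unfolding T_def using e R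
    by (auto simp: subset_iff dist_norm norm_axis_complex)
  then have T_ne: "T \<noteq> {}" by auto
  have T_bd: "r \<le> norm w1" if "r \<in> T" for r using that bad unfolding T_def by (metis (mono_tags, lifting) linear mem_Collect_eq)
  then have bdd: "bdd_above T" by (meson bdd_above.I)
  define s where "s = Sup T"
  have sR: "s < R" unfolding s_def using cSup_least[OF T_ne T_bd] w1 by linarith
  have s0: "s > 0" using cSup_upper[OF \<open>min e (R/2) \<in> T\<close> bdd] e R unfolding s_def by (simp add: min_def split: if_splits)
  have disc_s: "x0 + axis j w \<in> W" if w: "norm w < s" for w
  proof -
    obtain r where "r \<in> T" "norm w < r" using w unfolding s_def less_cSup_iff[OF T_ne bdd] by blast
    then show ?thesis unfolding T_def by auto
  qed
  define k where "k = 2 * DIM(complex ^ 'n) + 2"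
  \<comment> \<open>With p^(k+1) = s/R one has R p^k = s/p > s, so this p is admissible for every r
    < s.\<close>
  define p where "p = root (Suc k) (s / R)"
  have p: "0 < p" "p < 1" unfolding p_def using s0 sR R by (auto simp: real_root_gt_zero real_root_lt_1_iff)
  have "p ^ Suc k = s / R" unfolding p_def using s0 R by (intro real_root_pow_pos) auto
  then have pk: "R * p ^ k = s / p" using p R by (simp add: field_simps)
  \<comment> \<open>The midpoint of s p and s: r < s keeps the closed disc in W, and r > s p makes
    r/p exceed s.\<close>
  define r where "r = (s * p + s) / 2"
  have "s * p < s" using s0 p by simp
  then have r: "0 < r" "r < s" "s * p < r" unfolding r_def using s0 p by (auto intro: add_pos_pos)
  have "s \<le> s / p" using s0 p by (simp add: field_simps)
  then have rk: "r \<le> R * p ^ k" using r pk by simp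
  have step: "x0 + axis j w \<in> W" if "norm w < r / p" for w
    by (rule disc_step[OF r(1) p rk[unfolded k_def] discR _ that]) (use disc_s r in auto)
  have srp: "s < r / p" using r p by (simp add: field_simps)
  obtain r' where r': "s < r'" "r' < min (r / p) R" using dense[of s "min (r / p) R"] srp sR by auto
  then have "r' \<in> T" unfolding T_def using step s0 by auto
  then show False using cSup_upper[OF _ bdd, of r'] r'(1) unfolding s_def by simp
qed

end

subsection \<open>Extension along the leaves\<close>

text \<open>A nonempty open set is never null. Used both for uniqueness of extensions and for
  carrying complex linearity of a differential across E.\<close>

lemma continuous_zero_off_negligible:
  fixes h :: "'a::euclidean_space \<Rightarrow> 'b::real_normed_vector"
  assumes "open V" "continuous_on V h" "negligible E" "\<And>y. y \<in> V - E \<Longrightarrow> h y = 0" "z \<in> V"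
  shows "h z = 0"
proof (rule ccontr)
  assume "h z \<noteq> 0"
  define T where "T = V \<inter> h -` (- {0})"
  have "open T" unfolding T_def using assms(1,2) by (intro continuous_open_preimage) auto
  moreover have "z \<in> T" using assms(5) \<open>h z \<noteq> 0\<close> by (auto simp: T_def)
  moreover have "T \<subseteq> E" using assms(4) by (auto simp: T_def)
  ultimately show False using negligible_subset[OF assms(3)] open_not_negligible by blast
qed

text \<open>The largest open set over which F continues. Agreement is asked only off E, so a local
  extension may differ from F on E itself.\<close>

definition extension_set :: "(complex ^ 'n::finite) set \<Rightarrow> (complex ^ 'n) set \<Rightarrow> (complex ^ 'n \<Rightarrow> complex) \<Rightarrow> (complex ^ 'n) set"
  where "extension_set D E F = \<Union> {V. open V \<and> V \<subseteq> D \<and> (\<exists>G. holo_on V G \<and> (\<forall>y\<in>V - E. G y = F y))}"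

lemma open_extension_set: "open (extension_set D E F)"
  unfolding extension_set_def by auto

lemma extension_set_subset: "extension_set D E F \<subseteq> D"
  unfolding extension_set_def by auto

lemma extension_setI:
  "z \<in> V \<Longrightarrow> open V \<Longrightarrow> V \<subseteq> D \<Longrightarrow> holo_on V G \<Longrightarrow> (\<And>y. y \<in> V - E \<Longrightarrow> G y = F y) \<Longrightarrow> z \<in> extension_set D E F"
  unfolding extension_set_def by blast

text \<open>Local extensions are continuous and equal F off a null set, hence coincide on every
  overlap; there is no monodromy to obstruct the patching.\<close>

lemma extension_set_glue:
  fixes F :: "complex ^ 'n \<Rightarrow> complex"
  assumes "negligible E"
  obtains G where "holo_on (extension_set D E F) G" "\<And>z. z \<in> extension_set D E F - E \<Longrightarrow> G z = F z"
proof -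
  define P where "P V G \<longleftrightarrow> open V \<and> V \<subseteq> D \<and> holo_on V G \<and> (\<forall>y\<in>V - E. G y = F y)" for V G
  have unique: "G1 z = G2 z" if "P V1 G1" "P V2 G2" "z \<in> V1" "z \<in> V2" for V1 V2 G1 G2 z
  proof -
    have "continuous_on (V1 \<inter> V2) G1" "continuous_on (V1 \<inter> V2) G2"
      using that holo_on_imp_continuous_on continuous_on_subset inf_le1 inf_le2 unfolding P_def by metis+
    then have cont: "continuous_on (V1 \<inter> V2) (\<lambda>y. G1 y - G2 y)" by (rule continuous_on_diff)
    have "open (V1 \<inter> V2)" "z \<in> V1 \<inter> V2" using that by (simp_all add: P_def open_Int)
    moreover have "G1 y - G2 y = 0" if "y \<in> V1 \<inter> V2 - E" for y
      using that \<open>P V1 G1\<close> \<open>P V2 G2\<close> by (simp add: P_def)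
    ultimately have "G1 z - G2 z = 0"
      using continuous_zero_off_negligible[OF _ cont assms] by blast
    then show ?thesis by simp
  qed
  have "\<exists>V G. z \<in> V \<and> P V G" if "z \<in> extension_set D E F" for z
    using that unfolding extension_set_def P_def by auto
  then obtain V H where VH: "\<And>z. z \<in> extension_set D E F \<Longrightarrow> z \<in> V z \<and> P (V z) (H z)" by metis
  define G where "G z = H z z" for z
  have eq: "G y = H z y" if "z \<in> extension_set D E F" "y \<in> V z" for z y
  proof -
    have yE: "y \<in> extension_set D E F" using that VH[OF that(1)] unfolding P_def extension_set_def by blast
    then show ?thesis unfolding G_def using unique[of "V y" "H y" "V z" "H z" y] VH[OF yE] VH[OF that(1)] that(2) by simp
  qed
  show thesis
  proof (rule that[of G])
    show "holo_on (extension_set D E F) G"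
      unfolding holo_on_def
    proof
      fix z assume z: "z \<in> extension_set D E F"
      have zV: "z \<in> V z" "open (V z)" "holo_on (V z) (H z)" using VH[OF z] by (auto simp: P_def)
      obtain f' where f': "(H z has_derivative f') (at z)" "\<And>c v. f' (c *s v) = c * f' v"
        using zV unfolding holo_on_def by blast
      have "(G has_derivative f') (at z)"
        by (rule has_derivative_transform_within_open[OF f'(1), of "V z"]) (use zV eq[OF z] in auto)
      then show "\<exists>f'. (G has_derivative f') (at z) \<and> (\<forall>c v. f' (c *s v) = c * f' v)" using f'(2) by blast
    qed
    show "G z = F z" if "z \<in> extension_set D E F - E" for z
      unfolding G_def using VH[of z] that by (auto simp: P_def)
  qed
qed

section \<open>C^2 charts and propagation inside one chart\<close>

text \<open>The mean value inequality on a ball where the differential stays within 1 of its value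
  at x. It is applied to \<psi>, to \<phi>, and to the differential of \<phi>; in the last case the
  second derivative of the chart enters.\<close>

lemma Lipschitz_near_of_continuous_derivative:
  fixes f :: "'a::euclidean_space \<Rightarrow> 'b::real_normed_vector" and Df :: "'a \<Rightarrow> 'a \<Rightarrow>\<^sub>L 'b"
  assumes S: "open S" "x \<in> S" and der: "\<And>y. y \<in> S \<Longrightarrow> (f has_derivative blinfun_apply (Df y)) (at y)"
    and cont: "continuous_on S Df"
  obtains e L where "e > 0" "L \<ge> 0" "ball x e \<subseteq> S"
    "\<And>y z. y \<in> ball x e \<Longrightarrow> z \<in> ball x e \<Longrightarrow> norm (f y - f z) \<le> L * norm (y - z)"
proof -
  define T where "T = S \<inter> Df -` ball (Df x) 1"
  have "open T" unfolding T_def using S(1) cont by (intro continuous_open_preimage) auto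
  moreover have "x \<in> T" using S by (simp add: T_def)
  ultimately obtain e where e: "e > 0" "ball x e \<subseteq> T" using open_contains_ball by blast
  show thesis
  proof (rule that[OF e(1), of "norm (Df x) + 1"])
    show "ball x e \<subseteq> S" using e(2) by (auto simp: T_def)
    fix y z assume yz: "y \<in> ball x e" "z \<in> ball x e"
    show "norm (f y - f z) \<le> (norm (Df x) + 1) * norm (y - z)"
    proof (rule differentiable_bound[OF convex_ball _ _ yz])
      fix w assume w: "w \<in> ball x e"
      then have "w \<in> S" "dist (Df x) (Df w) < 1" using e(2) by (auto simp: T_def)
      then show "(f has_derivative blinfun_apply (Df w)) (at w within ball x e)"
        using der has_derivative_at_withinI by blast
      show "onorm (blinfun_apply (Df w)) \<le> norm (Df x) + 1"
        using \<open>dist (Df x) (Df w) < 1\<close> norm_triangle_sub[of "Df w" "Df x"]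
        unfolding norm_blinfun.rep_eq[symmetric] by (simp add: dist_norm norm_minus_commute)
    qed
  qed simp
qed

lemma C2_onE:
  assumes "C2_on S f"
  obtains Df D2f where "\<And>x. x \<in> S \<Longrightarrow> (f has_derivative blinfun_apply (Df x)) (at x)"
    "\<And>x. x \<in> S \<Longrightarrow> (Df has_derivative blinfun_apply (D2f x)) (at x)"
    "continuous_on S D2f" "continuous_on S Df" "continuous_on S f"
proof -
  obtain Df D2f where *: "\<And>x. x \<in> S \<Longrightarrow> (f has_derivative blinfun_apply (Df x)) (at x)"
    "\<And>x. x \<in> S \<Longrightarrow> (Df has_derivative blinfun_apply (D2f x)) (at x)" "continuous_on S D2f"
    using assms unfolding C2_on_def by blast
  show thesis
    by (rule that[of Df D2f])
      (use * in \<open>auto intro!: continuous_at_imp_continuous_on intro: has_derivative_continuous\<close>)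
qed

lemma mem_slice_axis:
  fixes c z :: "complex ^ 'n"
  assumes "z \<in> slice j c"
  shows "z = c + axis j (z $ j - c $ j)"
  using assms by (simp add: slice_def vec_eq_iff axis_def)

lemma line_param_eq: "line_param j c (c $ j + w) = c + axis j w"
  by (simp add: line_param_def vec_eq_iff axis_def)

text \<open>\<phi> is only real differentiable, but each of its components is holomorphic along the
  plaques, so its differential is complex linear in the leaf direction. Thus the pulled-back
  function is holomorphic along the j-lines.\<close>

lemma fol_chart_derivative_axis:
  assumes chart: "fol_chart j D U \<psi> \<phi>" and x: "x \<in> \<psi> ` U"
    and der: "(\<phi> has_derivative D\<phi>) (at x)"
  shows "D\<phi> (axis j w) = w *s D\<phi> (axis j 1)"
proof -
  have "open (\<psi> ` U)" using chart by (simp add: fol_chart_def)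
  have lin: "bounded_linear D\<phi>" using der by (rule has_derivative_bounded_linear)
  have "D\<phi> (axis j w) $ k = w * D\<phi> (axis j 1) $ k" for w k
  proof -
    let ?l = "\<lambda>w. x + axis j w"
    have "open {w. ?l w \<in> \<psi> ` U}"
      using open_vimage[OF \<open>open (\<psi> ` U)\<close>, of ?l] by (simp add: vimage_def continuous_intros)
    have "(\<lambda>\<zeta>. \<phi> (line_param j x \<zeta>) $ k) holomorphic_on {\<zeta>. line_param j x \<zeta> \<in> \<psi> ` U}"
      using chart by (simp add: fol_chart_def)
    \<comment> \<open>\<open>line_param\<close> uses the absolute j-th coordinate,
      \<open>axis\<close> an increment from x; the shift by \<open>x $ j\<close> converts one into
      the other.\<close>
    then have "(\<lambda>\<zeta>. \<phi> (line_param j x \<zeta>) $ k) \<circ> (\<lambda>w. x $ j + w) holomorphic_on {w. ?l w \<in> \<psi> ` U}"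
      by (intro holomorphic_on_compose_gen[where t="{\<zeta>. line_param j x \<zeta> \<in> \<psi> ` U}"] holomorphic_intros)
        (auto simp: line_param_eq)
    then have "(\<lambda>w. \<phi> (?l w) $ k) holomorphic_on {w. ?l w \<in> \<psi> ` U}"
      by (simp add: o_def line_param_eq)
    moreover have "0 \<in> {w. ?l w \<in> \<psi> ` U}" using x by simp
    ultimately obtain d where d: "((\<lambda>w. \<phi> (?l w) $ k) has_field_derivative d) (at 0)"
      using \<open>open {w. ?l w \<in> \<psi> ` U}\<close> holomorphic_on_imp_differentiable_at field_differentiable_def by blast
    have "(?l has_derivative axis j) (at 0)"
      using has_derivative_add[OF has_derivative_const bounded_linear_imp_has_derivative[OF bounded_linear_axis_complex]]
      by auto
    moreover have "(\<phi> has_derivative D\<phi>) (at (?l 0))" using der by simp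
    ultimately have "((\<lambda>w. \<phi> (?l w)) has_derivative (\<lambda>h. D\<phi> (axis j h))) (at 0)"
      by (rule has_derivative_compose)
    from bounded_linear.has_derivative[OF bounded_linear_vec_nth this]
    have "((\<lambda>w. \<phi> (?l w) $ k) has_derivative (\<lambda>h. D\<phi> (axis j h) $ k)) (at 0)" .
    then have "(\<lambda>h. D\<phi> (axis j h) $ k) = (*) d"
      using d has_derivative_unique unfolding has_field_derivative_def by blast
    then have *: "D\<phi> (axis j h) $ k = d * h" for h by (rule fun_cong)
    show ?thesis unfolding *[of w] *[of 1] mult_1_right by (rule mult.commute)
  qed
  then show ?thesis unfolding vec_eq_iff vector_smult_component by blast
qed

text \<open>The local step of continuation along leaves. It instantiates
  \<open>chart_extension\<close> in a ball about \<psi> p, with K and W the pullbacks of E and of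
  the extension set. One radius serves all pairs of points near p, as an induction over a connected
  plaque requires.\<close>

lemma fol_chart_extension_propagates:
  fixes F :: "complex ^ 'n \<Rightarrow> complex"
  assumes chart: "fol_chart j D U \<psi> \<phi>" and D_E: "open (D - E)" and "negligible E"
    and F_int: "set_integrable lborel D F" and F_holo: "holo_on (D - E) F"
    and saturated: "\<forall>x\<in>U \<inter> E. connected_component_set (U \<inter> \<psi> -` slice j (\<psi> x)) x \<subseteq> E"
    and p: "p \<in> U"
  obtains R where "R > 0"
    "\<And>q q'. q \<in> U \<Longrightarrow> q' \<in> U \<Longrightarrow> \<psi> q \<in> ball (\<psi> p) R \<Longrightarrow> \<psi> q' \<in> ball (\<psi> p) R \<Longrightarrow>
      \<psi> q' \<in> slice j (\<psi> q) \<Longrightarrow> q \<in> extension_set D E F \<Longrightarrow> q' \<in> extension_set D E F"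
proof -
  define X where "X = extension_set D E F"
  have openX: "open X" unfolding X_def by (rule open_extension_set)
  have U: "open U" "U \<subseteq> D" and \<Omega>: "open (\<psi> ` U)" and inv: "\<And>x. x \<in> U \<Longrightarrow> \<phi> (\<psi> x) = x"
    and C2: "C2_on U \<psi>" "C2_on (\<psi> ` U) \<phi>"
    using chart unfolding fol_chart_def by auto
  have inv': "\<phi> y \<in> U" "\<psi> (\<phi> y) = y" if "y \<in> \<psi> ` U" for y using that inv by auto
  obtain D\<psi> where D\<psi>: "\<And>x. x \<in> U \<Longrightarrow> (\<psi> has_derivative blinfun_apply (D\<psi> x)) (at x)"
    and D\<psi>_cont: "continuous_on U D\<psi>" and \<psi>_cont: "continuous_on U \<psi>"
    using C2(1) by (rule C2_onE) blast
  obtain D\<phi> D2\<phi> where D\<phi>: "\<And>x. x \<in> \<psi> ` U \<Longrightarrow> (\<phi> has_derivative blinfun_apply (D\<phi> x)) (at x)"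
    and D2\<phi>: "\<And>x. x \<in> \<psi> ` U \<Longrightarrow> (D\<phi> has_derivative blinfun_apply (D2\<phi> x)) (at x)"
    and D2\<phi>_cont: "continuous_on (\<psi> ` U) D2\<phi>" 
    and D\<phi>_cont: "continuous_on (\<psi> ` U) D\<phi>" and \<phi>_cont: "continuous_on (\<psi> ` U) \<phi>"
    using C2(2) by (rule C2_onE) blast
  obtain e L where e: "e > 0" "L \<ge> 0" "ball p e \<subseteq> U"
    and \<psi>_lip: "\<And>y z. y \<in> ball p e \<Longrightarrow> z \<in> ball p e \<Longrightarrow> norm (\<psi> y - \<psi> z) \<le> L * norm (y - z)"
    using Lipschitz_near_of_continuous_derivative[OF U(1) p D\<psi> D\<psi>_cont] by blast
  \<comment> \<open>The chart ball is taken so small that \<phi> sends it into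
    \<open>ball p e\<close>, where \<psi> is Lipschitz; the comparison of integrals rests on
    this.\<close>
  have "open (\<psi> ` U \<inter> \<phi> -` ball p e)" by (rule continuous_open_preimage[OF \<phi>_cont \<Omega> open_ball])
  moreover have "\<psi> p \<in> \<psi> ` U \<inter> \<phi> -` ball p e" using p inv e(1) by auto
  ultimately obtain \<rho> where \<rho>: "\<rho> > 0" "ball (\<psi> p) \<rho> \<subseteq> \<psi> ` U \<inter> \<phi> -` ball p e"
    using open_contains_ball by blast
  define B where "B = ball (\<psi> p) \<rho>"
  have B: "x \<in> \<psi> ` U" "\<phi> x \<in> ball p e" "\<phi> x \<in> U" "\<psi> (\<phi> x) = x" if "x \<in> B" for x
    using that \<rho>(2) e(3) inv'[of x] unfolding B_def by auto
  have \<phi>_cont_B: "continuous_on B \<phi>" using \<phi>_cont B(1) continuous_on_subset by blast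
  have openB: "open B" unfolding B_def by simp
  define K where "K = {x \<in> B. \<phi> x \<in> E}"
  define W where "W = {x \<in> B. \<phi> x \<in> X}"
  obtain G where G: "holo_on X G" "\<And>z. z \<in> X - E \<Longrightarrow> G z = F z"
    unfolding X_def using extension_set_glue[OF \<open>negligible E\<close>] by blast
  have DE_X: "z \<in> X" if "z \<in> D - E" for z
    unfolding X_def by (rule extension_setI[OF that D_E _ F_holo]) auto
  have "\<exists>D'. (G has_derivative blinfun_apply D') (at z)" if "z \<in> X" for z
    using G(1) that unfolding holo_on_def by (metis bounded_linear_Blinfun_apply has_derivative_bounded_linear)
  then obtain DG where DG: "\<And>z. z \<in> X \<Longrightarrow> (G has_derivative blinfun_apply (DG z)) (at z)" by metis
  have DG_linear: "DG z (c *s v) = c * DG z v" if "z \<in> X" for z c v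
    using G(1) DG[OF that] that has_derivative_unique unfolding holo_on_def by metis
  define g where "g x = G (\<phi> x)" for x
  define Dg where "Dg x = DG (\<phi> x) o\<^sub>L D\<phi> x" for x
  have "chart_extension j (\<psi> p) \<rho> K W g Dg"
    unfolding chart_extension_def B_def[symmetric]
  proof (intro conjI allI impI)
    show "open W" unfolding W_def
      using continuous_open_preimage[OF \<phi>_cont_B openB openX] by (simp add: vimage_def Int_def)
    show "W \<subseteq> B" by (auto simp: W_def)
    show "B - K \<subseteq> W" using DE_X B(3) U(2) by (auto simp: W_def K_def)
    have "B - K = B \<inter> \<phi> -` (D - E)" using B(3) U(2) by (auto simp: K_def)
    then show "open (B - K)" using continuous_open_preimage[OF \<phi>_cont_B openB D_E] by simp
    have openBK: "open (B - K)" by fact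
    have "K \<subseteq> \<psi> ` (E \<inter> U)" using B by (force simp: K_def)
    moreover have "negligible (\<psi> ` (E \<inter> U))"
    proof (rule negligible_differentiable_image_negligible)
      show "negligible (E \<inter> U)" using \<open>negligible E\<close> by (rule negligible_subset) auto
      show "\<psi> differentiable_on E \<inter> U"
        unfolding differentiable_on_def using D\<psi>
        by (auto intro: differentiableI has_derivative_at_withinI)
    qed simp
    ultimately show "negligible K" using negligible_subset by blast
    show "x + axis j w \<in> K" if x: "x \<in> B" and y: "x + axis j w \<in> B" and "x \<in> K" for x w
    proof -
      let ?y = "x + axis j w"
      \<comment> \<open>Convexity of the ball keeps the segment inside it, so both points lie in one
        connected plaque and saturation of E applies.\<close>
      have seg: "closed_segment x ?y \<subseteq> B" using x y unfolding B_def by (simp add: closed_segment_subset)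
      have seg_slice: "closed_segment x ?y \<subseteq> slice j x"
        unfolding closed_segment_def slice_def by (auto simp: axis_def algebra_simps)
      have "connected (\<phi> ` closed_segment x ?y)"
        by (intro connected_continuous_image continuous_on_subset[OF \<phi>_cont_B seg] connected_segment)
      moreover have "\<phi> ` closed_segment x ?y \<subseteq> U \<inter> \<psi> -` slice j (\<psi> (\<phi> x))"
        using seg seg_slice B(3,4) x by (auto simp: subset_iff)
      ultimately have "\<phi> ?y \<in> connected_component_set (U \<inter> \<psi> -` slice j (\<psi> (\<phi> x))) (\<phi> x)"
        by (auto simp: connected_component_def)
      then show ?thesis using saturated B(3)[OF x] \<open>x \<in> K\<close> y by (auto simp: K_def)
    qed
    show "(g has_derivative blinfun_apply (Dg x)) (at x)" if "x \<in> W" for x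
    proof -
      have "x \<in> B" "\<phi> x \<in> X" using that by (auto simp: W_def)
      from has_derivative_compose[OF D\<phi>[OF B(1)[OF this(1)]] DG[OF this(2)]]
      show ?thesis by (simp add: g_def[abs_def] Dg_def blinfun_compose.rep_eq o_def)
    qed
    show "Dg x (axis j w) = w * Dg x (axis j 1)" if "x \<in> W" for x w
    proof -
      have x: "x \<in> B" "\<phi> x \<in> X" using that by (auto simp: W_def)
      show ?thesis
        unfolding Dg_def blinfun_apply_blinfun_compose
        using fol_chart_derivative_axis[OF chart B(1)[OF x(1)] D\<phi>[OF B(1)[OF x(1)]], of w] DG_linear[OF x(2)] by simp
    qed
    show "\<exists>\<epsilon>>0. \<exists>L. \<forall>y\<in>ball x \<epsilon>. \<forall>z\<in>ball x \<epsilon>. norm (Dg y - Dg z) \<le> L * norm (y - z)" if "x \<in> W" for x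
    proof -
      have x: "x \<in> B" "\<phi> x \<in> X" using that by (auto simp: W_def)
      have x\<Omega>: "x \<in> \<psi> ` U" using B x by blast
      obtain \<epsilon>1 L1 DG' where \<epsilon>1: "\<epsilon>1 > 0" "ball (\<phi> x) \<epsilon>1 \<subseteq> X"
        and DG': "\<And>z. z \<in> ball (\<phi> x) \<epsilon>1 \<Longrightarrow> (G has_derivative blinfun_apply (DG' z)) (at z)"
          "\<And>z y. z \<in> ball (\<phi> x) \<epsilon>1 \<Longrightarrow> y \<in> ball (\<phi> x) \<epsilon>1 \<Longrightarrow> norm (DG' z - DG' y) \<le> L1 * norm (z - y)"
      proof (rule holo_on_locally_Lipschitz_derivative[OF G(1) openX x(2)])
        fix \<epsilon> L DG'
        assume "\<epsilon> > 0" "ball (\<phi> x) \<epsilon> \<subseteq> X"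
          "\<And>z. z \<in> ball (\<phi> x) \<epsilon> \<Longrightarrow> (G has_derivative blinfun_apply (DG' z)) (at z)"
          "\<And>z y. z \<in> ball (\<phi> x) \<epsilon> \<Longrightarrow> y \<in> ball (\<phi> x) \<epsilon> \<Longrightarrow> norm (DG' z - DG' y) \<le> L * norm (z - y)"
        then show thesis by (rule that)
      qed
      have "DG' z = DG z" if "z \<in> ball (\<phi> x) \<epsilon>1" for z
        using has_derivative_unique[OF DG'(1)[OF that] DG] \<epsilon>1(2) that by (intro blinfun_eqI) (auto simp: fun_eq_iff)
      then have DG_lip: "norm (DG z - DG y) \<le> \<bar>L1\<bar> * norm (z - y)" if "z \<in> ball (\<phi> x) \<epsilon>1" "y \<in> ball (\<phi> x) \<epsilon>1" for z y
        using DG'(2)[OF that] that by (smt (verit) mult_right_mono norm_ge_zero)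
      obtain \<epsilon>2 L2 where \<epsilon>2: "\<epsilon>2 > 0" "L2 \<ge> 0" "ball x \<epsilon>2 \<subseteq> \<psi> ` U"
        and \<phi>_lip: "\<And>y z. y \<in> ball x \<epsilon>2 \<Longrightarrow> z \<in> ball x \<epsilon>2 \<Longrightarrow> norm (\<phi> y - \<phi> z) \<le> L2 * norm (y - z)"
        using Lipschitz_near_of_continuous_derivative[OF \<Omega> x\<Omega> D\<phi> D\<phi>_cont] by blast
      obtain \<epsilon>3 L3 where \<epsilon>3: "\<epsilon>3 > 0" "L3 \<ge> 0" "ball x \<epsilon>3 \<subseteq> \<psi> ` U"
        and D\<phi>_lip: "\<And>y z. y \<in> ball x \<epsilon>3 \<Longrightarrow> z \<in> ball x \<epsilon>3 \<Longrightarrow> norm (D\<phi> y - D\<phi> z) \<le> L3 * norm (y - z)"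
        using Lipschitz_near_of_continuous_derivative[OF \<Omega> x\<Omega> D2\<phi> D2\<phi>_cont] by blast
      \<comment> \<open>The bound \<epsilon>1 / (L2 + 1) makes \<phi> map the ball into the one
        where DG is Lipschitz, with 1 added in case L2 = 0. The bound 1 limits the variation of
        D\<phi> to L3.\<close>
      define \<epsilon> where "\<epsilon> = min (min \<epsilon>2 \<epsilon>3) (min 1 (\<epsilon>1 / (L2 + 1)))"
      have \<epsilon>: "\<epsilon> > 0" "\<epsilon> \<le> \<epsilon>2" "\<epsilon> \<le> \<epsilon>3" "\<epsilon> \<le> 1" "\<epsilon> \<le> \<epsilon>1 / (L2 + 1)"
        unfolding \<epsilon>_def using \<epsilon>1(1) \<epsilon>2(1,2) \<epsilon>3(1) by auto
      have near: "\<phi> y \<in> ball (\<phi> x) \<epsilon>1" "norm (DG (\<phi> y)) \<le> norm (DG (\<phi> x)) + \<bar>L1\<bar> * \<epsilon>1"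
        "norm (D\<phi> y) \<le> norm (D\<phi> x) + L3" if y: "y \<in> ball x \<epsilon>" for y
      proof -
        have d: "norm (x - y) < \<epsilon>" using y by (simp add: dist_norm)
        have "norm (\<phi> x - \<phi> y) \<le> L2 * norm (x - y)" by (rule \<phi>_lip) (use y \<epsilon> in auto)
        also have "\<dots> \<le> L2 * (\<epsilon>1 / (L2 + 1))" using d \<epsilon>(5) \<epsilon>2(2) by (intro mult_left_mono) auto
        also have "\<dots> < \<epsilon>1" using \<epsilon>1(1) \<epsilon>2(2) by (simp add: field_simps)
        finally have n: "norm (\<phi> x - \<phi> y) < \<epsilon>1" .
        then show *: "\<phi> y \<in> ball (\<phi> x) \<epsilon>1" by (simp add: dist_norm)
        have "norm (DG (\<phi> y) - DG (\<phi> x)) \<le> \<bar>L1\<bar> * norm (\<phi> y - \<phi> x)" using * \<epsilon>1(1) by (intro DG_lip) auto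
        also have "\<dots> \<le> \<bar>L1\<bar> * \<epsilon>1" using n by (intro mult_left_mono) (auto simp: norm_minus_commute)
        finally show "norm (DG (\<phi> y)) \<le> norm (DG (\<phi> x)) + \<bar>L1\<bar> * \<epsilon>1"
          using norm_triangle_sub[of "DG (\<phi> y)" "DG (\<phi> x)"] by linarith
        have "norm (D\<phi> y - D\<phi> x) \<le> L3 * norm (y - x)" by (rule D\<phi>_lip) (use y \<epsilon> \<epsilon>3(1) in auto)
        also have "\<dots> \<le> L3 * 1" using d \<epsilon>(4) \<epsilon>3(2) by (intro mult_left_mono) (auto simp: norm_minus_commute)
        finally show "norm (D\<phi> y) \<le> norm (D\<phi> x) + L3"
          using norm_triangle_sub[of "D\<phi> y" "D\<phi> x"] by linarith
      qed
      \<comment> \<open>The product estimate for DG(\<phi> x) composed with D\<phi> x: DG is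
        Lipschitz by holomorphy, D\<phi> because the chart is C^2.\<close>
      define c where "c = \<bar>L1\<bar> * L2 * (norm (D\<phi> x) + L3) + (norm (DG (\<phi> x)) + \<bar>L1\<bar> * \<epsilon>1) * L3"
      have "norm (Dg y - Dg z) \<le> c * norm (y - z)" if y: "y \<in> ball x \<epsilon>" and z: "z \<in> ball x \<epsilon>" for y z
      proof -
        have eq: "Dg y - Dg z = ((DG (\<phi> y) - DG (\<phi> z)) o\<^sub>L D\<phi> y) + (DG (\<phi> z) o\<^sub>L (D\<phi> y - D\<phi> z))"
          unfolding Dg_def by (rule blinfun_eqI) (simp add: blinfun.diff_left blinfun.diff_right blinfun.add_left)
        have 1: "norm ((DG (\<phi> y) - DG (\<phi> z)) o\<^sub>L D\<phi> y) \<le> (\<bar>L1\<bar> * (L2 * norm (y - z))) * (norm (D\<phi> x) + L3)"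
        proof (rule order_trans[OF norm_blinfun_compose mult_mono])
          have "norm (DG (\<phi> y) - DG (\<phi> z)) \<le> \<bar>L1\<bar> * norm (\<phi> y - \<phi> z)" by (intro DG_lip near y z)
          also have "\<dots> \<le> \<bar>L1\<bar> * (L2 * norm (y - z))" using y z \<epsilon> by (intro mult_left_mono \<phi>_lip) auto
          finally show "norm (DG (\<phi> y) - DG (\<phi> z)) \<le> \<bar>L1\<bar> * (L2 * norm (y - z))" .
        qed (use near y \<epsilon>2(2) in auto)
        have 2: "norm (DG (\<phi> z) o\<^sub>L (D\<phi> y - D\<phi> z)) \<le> (norm (DG (\<phi> x)) + \<bar>L1\<bar> * \<epsilon>1) * (L3 * norm (y - z))"
          by (rule order_trans[OF norm_blinfun_compose mult_mono]) (use near z y D\<phi>_lip \<epsilon> \<epsilon>1(1) in auto)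
        show ?thesis unfolding eq using norm_triangle_le[OF add_mono[OF 1 2]] by (simp add: c_def algebra_simps)
      qed
      then show ?thesis using \<epsilon>(1) by blast
    qed
    show "(\<integral>\<^sup>+x\<in>B - K. ennreal (norm (g x)) \<partial>lborel) < \<infinity>"
    proof -
      define F0 where "F0 z = ennreal (norm (indicator D z *\<^sub>R F z))" for z
      have F_int': "integrable lborel (\<lambda>z. indicator D z *\<^sub>R F z)" using F_int by (simp add: set_integrable_def)
      have F0: "F0 \<in> borel_measurable borel"
        unfolding F0_def
        using measurable_compose[OF measurable_compose[OF borel_measurable_integrable[OF F_int'] borel_measurable_norm] measurable_ennreal]
        by (simp only: measurable_lborel2)
      have fin: "(\<integral>\<^sup>+z. F0 z \<partial>lborel) < \<infinity>"
        unfolding F0_def using F_int' unfolding integrable_iff_bounded by simp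
      have "(\<integral>\<^sup>+x\<in>B - K. ennreal (norm (g x)) \<partial>lborel) = (\<integral>\<^sup>+x\<in>B - K. F0 (\<phi> x) \<partial>lborel)"
      proof (intro nn_integral_cong)
        fix x
        show "ennreal (norm (g x)) * indicator (B - K) x = F0 (\<phi> x) * indicator (B - K) x"
        proof (cases "x \<in> B - K")
          case True
          then have "\<phi> x \<in> D - E" using B(3) U(2) by (auto simp: K_def)
          then show ?thesis using G(2)[of "\<phi> x"] DE_X[of "\<phi> x"] by (simp add: g_def F0_def)
        qed simp
      qed
      also have "\<dots> \<le> ennreal ((5 * L) ^ DIM(complex ^ 'n)) * (\<integral>\<^sup>+x. F0 x \<partial>lborel)"
      proof (rule nn_integral_lipschitz_inverse_le[where Q="ball p e" and \<psi>=\<psi>, OF openBK open_ball e(2)])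
        show "continuous_on (B - K) \<phi>" using \<phi>_cont_B continuous_on_subset by blast
        show "\<phi> ` (B - K) \<subseteq> ball p e" using B by auto
        show "continuous_on (ball p e) \<psi>" using \<psi>_cont e(3) continuous_on_subset by blast
      qed (use B e(3) inv \<psi>_lip F0 in \<open>auto simp: dist_norm\<close>)
      also have "\<dots> < \<infinity>" using fin by (simp add: ennreal_mult_less_top)
      finally show ?thesis .
    qed
    show "V \<subseteq> W" if V: "open V" "V \<subseteq> B" and H: "\<forall>x. x \<in> V \<longrightarrow> (H has_derivative blinfun_apply (H' x)) (at x)"
      "continuous_on V H'" "\<forall>x. x \<in> V - K \<longrightarrow> H x = g x" for V H H'
    proof
      fix x assume x: "x \<in> V"
      define V' where "V' = U \<inter> \<psi> -` V"
      have V': "open V'" unfolding V'_def by (rule continuous_open_preimage[OF \<psi>_cont U(1) V(1)])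
      have V'D: "V' \<subseteq> D" "V' \<subseteq> U" using U by (auto simp: V'_def)
      define T where "T z = H' (\<psi> z) o\<^sub>L D\<psi> z" for z
      have T: "((\<lambda>z. H (\<psi> z)) has_derivative blinfun_apply (T z)) (at z)" if "z \<in> V'" for z
      proof -
        have "z \<in> U" "\<psi> z \<in> V" using that by (auto simp: V'_def)
        from has_derivative_compose[OF D\<psi>[OF this(1)] H(1)[rule_format, OF this(2)]] show ?thesis
          by (simp add: T_def blinfun_compose.rep_eq o_def)
      qed
      have HF: "H (\<psi> z) = F z" if z: "z \<in> V' - E" for z
      proof -
        have "\<psi> z \<in> V - K" "z \<in> D - E" "z \<in> U" using z inv U(2) by (auto simp: V'_def K_def)
        then show ?thesis using H(3)[rule_format, of "\<psi> z"] inv G(2)[of z] DE_X[of z] by (simp add: g_def)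
      qed
      have V'E: "open (V' - E)"
      proof -
        have "V' - E = V' \<inter> (D - E)" using V'D by auto
        then show ?thesis using V' D_E by (metis open_Int)
      qed
      have T_lin: "T z (c *s v) = c * T z v" if z: "z \<in> V'" for z c v
      proof -
        \<comment> \<open>Here it matters that H is C^1: continuity of its differential carries
          complex linearity from the complement of the null set E to all of V'.\<close>
        have "continuous_on V' T" unfolding T_def
          by (intro continuous_intros continuous_on_compose2[OF H(2)] continuous_on_subset[OF D\<psi>_cont] 
              continuous_on_subset[OF \<psi>_cont]) (auto simp: V'_def)
        then have cont: "continuous_on V' (\<lambda>z. T z (c *s v) - c * T z v)" by (intro continuous_intros)
        have "T y (c *s v) - c * T y v = 0" if y: "y \<in> V' - E" for y
        proof -
          have "y \<in> D - E" using y V'D by auto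
          then obtain f' where f': "(F has_derivative f') (at y)" "\<And>c v. f' (c *s v) = c * f' v"
            using F_holo unfolding holo_on_def by blast
          have "((\<lambda>z. H (\<psi> z)) has_derivative f') (at y)"
            by (rule has_derivative_transform_within_open[OF f'(1) V'E y]) (use HF in auto)
          then have "blinfun_apply (T y) = f'" using T[of y] y has_derivative_unique by blast
          then show ?thesis using f'(2) by simp
        qed
        from continuous_zero_off_negligible[OF V' cont \<open>negligible E\<close> this z] show ?thesis by simp
      qed
      have "holo_on V' (\<lambda>z. H (\<psi> z))" unfolding holo_on_def using T T_lin by blast
      moreover have "\<phi> x \<in> V'" using x V(2) B by (auto simp: V'_def)
      ultimately have "\<phi> x \<in> X" unfolding X_def by (intro extension_setI[OF _ V' V'D(1) _ HF])
      then show "x \<in> W" using x V(2) by (auto simp: W_def)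
    qed
  qed
  then interpret chart_extension j "\<psi> p" \<rho> K W g Dg .
  show thesis
  \<comment> \<open>Two points within \<rho>/4 of the centre are less than \<rho>/2 apart, and a
    disc of radius \<rho>/2 about either still lies in the ball of radius \<rho>.\<close>
  proof (rule that[of "\<rho> / 4"])
    show "\<rho> / 4 > 0" using \<rho> by simp
    fix q q' assume q: "q \<in> U" "q' \<in> U" "\<psi> q \<in> ball (\<psi> p) (\<rho> / 4)" "\<psi> q' \<in> ball (\<psi> p) (\<rho> / 4)"
      "\<psi> q' \<in> slice j (\<psi> q)" "q \<in> extension_set D E F"
    define w1 where "w1 = \<psi> q' $ j - \<psi> q $ j"
    have w1: "\<psi> q' = \<psi> q + axis j w1" unfolding w1_def by (rule mem_slice_axis[OF q(5)])
    have "norm w1 = dist (\<psi> q) (\<psi> q')" unfolding w1 by (simp add: dist_norm norm_axis_complex)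
    also have "\<dots> < \<rho> / 2" using q(3,4) dist_triangle[of "\<psi> q" "\<psi> q'" "\<psi> p"] by (simp add: dist_commute)
    finally have nw: "norm w1 < \<rho> / 2" .
    have "\<psi> q \<in> B" using q(3) \<rho>(1) by (auto simp: B_def)
    then have "\<psi> q \<in> W" using q(1,6) inv by (simp add: W_def X_def)
    moreover have "\<psi> q + axis j w \<in> ball (\<psi> p) \<rho>" if "norm w \<le> \<rho> / 2" for w
    proof -
      have "dist (\<psi> p) (\<psi> q + axis j w) \<le> dist (\<psi> p) (\<psi> q) + norm w"
        using dist_triangle[of "\<psi> p" "\<psi> q + axis j w" "\<psi> q"] by (simp add: dist_norm norm_axis_complex)
      then show ?thesis using q(3) that \<rho>(1) unfolding mem_ball by linarith
    qed
    ultimately have "\<psi> q' \<in> W" unfolding w1 using nw by (rule disc_extension)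
    then show "q' \<in> extension_set D E F" using inv[OF q(2)] by (simp add: W_def X_def)
  qed
qed

section \<open>From plaques to whole leaves\<close>

text \<open>A plaque is connected, and by the local step membership in the extension set is locally
  constant along it.\<close>

lemma same_plaque_extends:
  fixes F :: "complex ^ 'n \<Rightarrow> complex"
  assumes chart: "fol_chart j D U \<psi> \<phi>" and "open (D - E)" "negligible E" "set_integrable lborel D F" "holo_on (D - E) F"
    and saturated: "\<forall>x\<in>U \<inter> E. connected_component_set (U \<inter> \<psi> -` slice j (\<psi> x)) x \<subseteq> E"
    and x: "x \<in> U" and y: "y \<in> connected_component_set (U \<inter> \<psi> -` slice j (\<psi> x)) x"
    and "y \<in> extension_set D E F"
  shows "x \<in> extension_set D E F"
proof -
  define C where "C = connected_component_set (U \<inter> \<psi> -` slice j (\<psi> x)) x"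
  have C_sub: "C \<subseteq> U \<inter> \<psi> -` slice j (\<psi> x)" unfolding C_def by (rule connected_component_subset)
  have slice: "\<psi> b \<in> slice j (\<psi> a)" if "a \<in> C" "b \<in> C" for a b
  proof -
    have "\<psi> a \<in> slice j (\<psi> x)" "\<psi> b \<in> slice j (\<psi> x)" using that C_sub by auto
    then show ?thesis by (simp add: slice_def)
  qed
  have "open U" "C2_on U \<psi>" using chart by (auto simp: fol_chart_def)
  then have \<psi>_cont: "continuous_on U \<psi>" by (auto elim: C2_onE)
  have "x \<in> C" unfolding C_def using x by (auto simp: slice_def)
  have "y \<in> C" using y by (simp add: C_def)
  have "connected C" by (simp add: C_def)
  show ?thesis
  proof (rule connected_induction_simple[where P="\<lambda>z. z \<in> extension_set D E F",
        OF \<open>connected C\<close> \<open>y \<in> C\<close> \<open>x \<in> C\<close> assms(9)])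
    fix p assume "p \<in> C"
    then have "p \<in> U" using C_sub by auto
    obtain R where R: "R > 0" "\<And>q q'. q \<in> U \<Longrightarrow> q' \<in> U \<Longrightarrow> \<psi> q \<in> ball (\<psi> p) R \<Longrightarrow> \<psi> q' \<in> ball (\<psi> p) R \<Longrightarrow>
      \<psi> q' \<in> slice j (\<psi> q) \<Longrightarrow> q \<in> extension_set D E F \<Longrightarrow> q' \<in> extension_set D E F"
      using fol_chart_extension_propagates[OF assms(1-5) saturated \<open>p \<in> U\<close>] by blast
    \<comment> \<open>The local step is symmetric in the two points, so membership passes between
      any two points of this relative neighbourhood of p.\<close>
    define T where "T = C \<inter> (U \<inter> \<psi> -` ball (\<psi> p) R)"
    have "open (U \<inter> \<psi> -` ball (\<psi> p) R)" by (rule continuous_open_preimage[OF \<psi>_cont \<open>open U\<close> open_ball])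
    then have "openin (top_of_set C) T" unfolding T_def by (simp add: openin_open_Int)
    moreover have "p \<in> T" using \<open>p \<in> C\<close> \<open>p \<in> U\<close> R(1) by (simp add: T_def)
    moreover have "\<forall>a\<in>T. \<forall>b\<in>T. a \<in> extension_set D E F \<longrightarrow> b \<in> extension_set D E F"
      unfolding T_def using R(2) slice by (metis IntE vimageE)
    ultimately show "\<exists>T. openin (top_of_set C) T \<and> p \<in> T \<and>
        (\<forall>a\<in>T. \<forall>b\<in>T. a \<in> extension_set D E F \<longrightarrow> b \<in> extension_set D E F)" by blast
  qed
qed

theorem theorem1p2:
  fixes D D' E :: "(complex ^ 'n::finite) set"
    and j :: 'n
    and A :: "((complex ^ 'n) set \<times> (complex ^ 'n \<Rightarrow> complex ^ 'n) \<times> (complex ^ 'n \<Rightarrow> complex ^ 'n)) set"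
    and F :: "complex ^ 'n \<Rightarrow> complex"
  assumes "open D" and "connected D"
    and "holo_foliation j D A"
    and "closedin (top_of_set D) E" and "E \<subseteq> D"
    and "\<forall>L\<in>leaves j D A. L \<inter> E \<noteq> {} \<longrightarrow> L \<subseteq> E"
    and "hausdorff_measure (2 * real CARD('n)) E = 0"
    and "set_integrable lborel D F"
    and "holo_on (D - E) F"
    and "open D'" and "D' \<subseteq> D"
    and "\<exists>G. holo_on D' G \<and> (\<forall>z\<in>D' - E. G z = F z)"
    and "\<forall>L\<in>leaves j D A. L \<subseteq> E \<longrightarrow> L \<inter> D' \<noteq> {}"
  shows "\<exists>G. holo_on D G \<and> (\<forall>z\<in>D - E. G z = F z)"
proof -
  let ?X = "extension_set D E F"
  have charts: "fol_chart j D U \<psi> \<phi>" if "(U, \<psi>, \<phi>) \<in> A" for U \<psi> \<phi>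
    using assms(3) that unfolding holo_foliation_def by blast
  have "openin (top_of_set D) (D - E)" using assms(4) by (simp add: openin_diff)
  then have DE: "open (D - E)" using assms(1) by (simp add: openin_open_eq)
  have neg: "negligible E"
    using assms(7) by (intro hausdorff_measure_zero_imp_negligible) (simp add: mult.commute)
  have leaf_E: "leaf j A x \<subseteq> E" if "x \<in> E" for x
  proof -
    have "leaf j A x \<in> leaves j D A" using that assms(5) by (auto simp: leaves_def)
    moreover have "x \<in> leaf j A x" by (simp add: leaf_def)
    ultimately show ?thesis using assms(6) that by blast
  qed
  \<comment> \<open>Leafwise saturation restated for single plaques, the form in which a chart can
    use it.\<close>
  have plaque_E: "y \<in> E" if "same_plaque j A x y" "x \<in> E" for x y
    using leaf_E[OF that(2)] that(1) by (auto simp: leaf_def)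
  have plaque_X: "x \<in> ?X" if plaque: "same_plaque j A x y" and y: "y \<in> ?X" for x y
  proof -
    obtain U \<psi> \<phi> where U: "(U, \<psi>, \<phi>) \<in> A" "x \<in> U" "y \<in> connected_component_set (U \<inter> \<psi> -` slice j (\<psi> x)) x"
      using plaque unfolding same_plaque_def by blast
    show ?thesis
    proof (rule same_plaque_extends[OF charts[OF U(1)] DE neg assms(8,9) _ U(2,3) y])
      show "\<forall>a\<in>U \<inter> E. connected_component_set (U \<inter> \<psi> -` slice j (\<psi> a)) a \<subseteq> E"
      proof (intro ballI subsetI)
        fix a b assume a: "a \<in> U \<inter> E" and "b \<in> connected_component_set (U \<inter> \<psi> -` slice j (\<psi> a)) a"
        then have "same_plaque j A a b" unfolding same_plaque_def using U(1) by blast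
        then show "b \<in> E" using a plaque_E by blast
      qed
    qed
  qed
  have "D \<subseteq> ?X"
  proof
    fix z assume "z \<in> D"
    show "z \<in> ?X"
    proof (cases "z \<in> E")
      case False
      then show ?thesis by (intro extension_setI[OF _ DE _ assms(9)]) (use \<open>z \<in> D\<close> in auto)
    next
      case True
      have "leaf j A z \<in> leaves j D A" using \<open>z \<in> D\<close> by (auto simp: leaves_def)
      then obtain d where d: "(same_plaque j A)\<^sup>*\<^sup>* z d" "d \<in> D'"
        using assms(13) leaf_E[OF True] by (auto simp: leaf_def)
      obtain G where "holo_on D' G" "\<And>y. y \<in> D' - E \<Longrightarrow> G y = F y" using assms(12) by blast
      then have "d \<in> ?X" using extension_setI[OF d(2) assms(10,11)] by blast
      \<comment> \<open>The plaque chain from z to d is run backwards, starting at d in D'; this is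
        why \<open>plaque_X\<close> transfers membership from the second point to the first.\<close>
      with d(1) show ?thesis by (induction rule: converse_rtranclp_induct) (auto intro: plaque_X)
    qed
  qed
  then have "?X = D" using extension_set_subset[of D E F] by auto
  then show ?thesis using extension_set_glue[OF neg, of D F] by metis
qed

end
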